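(* Let $n\geq 3$ be an odd integer, $k:=\frac{n-3}{2}$, and $0<\epsilon<1$. Let $\mathbb{B}\subset\mathbb{R}^n$ be the open unit ball and let $f\in C_c^{\infty}(\mathbb{B})$ be radial; write $f(x)=f(|x|)$, so that $f$ also denotes the radial profile, a function of one variable. For $t\in(0,1)$ put $$h_k(t)=\frac{4^{k}\,\omega_{2k+2}\,t^{2k+1}}{\omega_{2k+1}}\,\mathcal{R}f(p,t),\qquad p\in\mathbb{S}^{n-1}$$ (this does not depend on $p$ since $f$ is radial). Then for every $t\in(0,1)$, $$\left[\frac{\mathrm{d}}{\mathrm{d} t}D^{2k}h_{k}\right](t)=(-1)^{k}k!\,4^{k}\sum_{m=0}^{k}\sum_{\nu=m}^{k}\sum_{l=\nu}^{k}2^{l+m-\nu}\frac{(2k-l)!}{(k-l)!\,m!}\binom{l+1}{\nu+1}\binom{l+\nu-m}{\nu-m}\frac{1}{t^{l}}\frac{(1-t)^{\nu+1}}{t^{\nu-m}}f^{(m)}(1-t).$$ Moreover $f$ is recovered on the annulus $\mathbb{B}(\epsilon,1)=\{x:\epsilon<|x|<1\}$ by solving this linear ODE for the unknown $f$ with the initial conditions $f^{(i)}(1-\epsilon')=0$, $0\leq i\leq k-1$, where $\epsilon'>0$ is small enough that $1-\epsilon'>\epsilon$ and $1-\epsilon'$ lies outside the support of the profile $f$. (For $k=0$ the identity reads $h_0'(t)=(1-t)f(1-t)$ and no initial conditions are needed.)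
   Context: The spherical mean transform is $\mathcal{R}f(p,t)=\frac{1}{\omega_{n-1}}\int_{\mathbb{S}^{n-1}}f(p+t\theta)\,\mathrm{d}S(\theta)$, where $\omega_{m}$ denotes the surface area of the unit sphere $\mathbb{S}^{m}\subset\mathbb{R}^{m+1}$ and $\mathrm{d}S$ is surface measure. $D$ denotes the operator $(D\varphi)(t)=\frac{1}{t}\frac{\mathrm{d}\varphi}{\mathrm{d}t}(t)$, and $D^{j}$ its $j$-fold iterate. $f^{(m)}$ is the $m$-th derivative of the radial profile. Binomial coefficients $\binom{a}{b}$ are $0$ when $b>a$ or $b<0$. *)

theory Defs
  imports "HOL-Analysis.Analysis"
begin

definition dir_deriv :: "'a::real_normed_vector \<Rightarrow> ('a \<Rightarrow> real) \<Rightarrow> 'a \<Rightarrow> real" where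
  "dir_deriv v F = (\<lambda>x. frechet_derivative F (at x) v)"

definition C_infinity :: "('a::real_normed_vector \<Rightarrow> real) \<Rightarrow> bool" where
  "C_infinity f \<longleftrightarrow> (\<forall>vs x. foldr dir_deriv vs f differentiable (at x))"

text \<open>Surface measure on the unit sphere (cone-measure construction):
  sigma(A) = n * lambda({r*theta : 0 < r < 1, theta in A}), i.e. n times the push-forward of
  Lebesgue measure on the open unit ball under x / |x|.\<close>
definition sphere_surface_measure :: "'a::euclidean_space measure" where
  "sphere_surface_measure =
     scale_measure (of_nat DIM('a))
       (distr (restrict_space lborel (ball 0 1)) borel (\<lambda>x. x /\<^sub>R norm x))"

text \<open>omega m = surface area of the unit sphere S^m in R^(m+1).\<close>
definition sphere_area :: "nat \<Rightarrow> real" where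
  "sphere_area m = 2 * pi powr (real (m + 1) / 2) / Gamma (real (m + 1) / 2)"

definition spherical_mean :: "('a::euclidean_space \<Rightarrow> real) \<Rightarrow> 'a \<Rightarrow> real \<Rightarrow> real" where
  "spherical_mean f p t =
     (1 / sphere_area (DIM('a) - 1)) *
       (\<integral>\<theta>. f (p + t *\<^sub>R \<theta>) \<partial>(sphere_surface_measure :: 'a measure))"

definition Dop :: "(real \<Rightarrow> real) \<Rightarrow> real \<Rightarrow> real" where
  "Dop \<phi> = (\<lambda>t. deriv \<phi> t / t)"

text \<open>The right-hand side of the identity, with F m standing for f^(m)(1-t).\<close>
definition sm_sum :: "nat \<Rightarrow> (nat \<Rightarrow> real) \<Rightarrow> real \<Rightarrow> real" where
  "sm_sum k F t = (-1)^k * fact k * 4^k *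
     (\<Sum>m=0..k. \<Sum>\<nu>=m..k. \<Sum>l=\<nu>..k.
        2 ^ (l + m - \<nu>) * (fact (2*k - l) / (fact (k - l) * fact m))
        * real ((l + 1) choose (\<nu> + 1)) * real ((l + \<nu> - m) choose (\<nu> - m))
        * (1 / t ^ l) * ((1 - t) ^ (\<nu> + 1) / t ^ (\<nu> - m)) * F m)"

end

theory Submission
  imports Defs "HOL-Probability.Probability"
begin

text \<open>
  Write $n = 2k+3$. For radial $f$ the spherical mean is a one-dimensional integral of the profile
  against $(1-s^2)^k$ (Funk--Hecke). The substitution $r^2 = 1 + t^2 + 2ts$ turns $h_k$ into the
  integral of $r f(r) P(r,t)^k$ over $1-t \<le> r \<le> 1$, where
  $P = -(t^2 - (1-r)^2)(t^2 - (1+r)^2)$ has degree 2 in $t^2$. As $D$ is twice the derivative with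
  respect to $t^2$, the function $D^{2k} P^k$ is constant in $t$, so only boundary terms at $r = 1-t$
  survive in the derivative of $D^{2k} h_k$. They are $t D^l [c_l (1-t)^{l+1} f(1-t)/t]$ for
  $l \<le> k$, and expanding $t D^l[\<phi>/t]$ with Bessel polynomial coefficients and
  $(1-t)^{l+1} f(1-t)$ by Leibniz gives the triple sum. Uniqueness is Gronwall's
  inequality, since the coefficient of the top derivative does not vanish on $(0,1)$.
\<close>

section \<open>The Funk--Hecke formula for cone measure\<close>

text \<open>The support of f fixes the upper limit of integration: the substitution ranges over
  [1-t, 1+t], and since the profile vanishes from 1 on, the part beyond 1 drops out and no boundary
  term arises there. At the moving limit r = 1-t one has (1-r)^2 = t^2, so t^2 is a root of order k
  of P^k as a polynomial in t^2. Boundary terms therefore vanish until k derivatives have fallen on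
  P^k. A term released after j >= k of them still undergoes l = 2k - j applications of D, which is
  the index l of the triple sum; m is the number of derivatives falling on f, and \<nu> - m is the
  index of the Bessel coefficient. Because the kernel is a polynomial in t^2 whose coefficients are
  continuous in r, the powers of t leave the integral, and no differentiation under the integral
  sign is required. The profile \<open>g\<close> is tied to f on [0, infinity) only, so all
  statements on its derivatives live on the open half-line.\<close>

text \<open>
  The moments of $p \<cdot> \<theta>$ are read off from a standard Gaussian vector $X$, because $p \<cdot> X$ is
  standard normal for every unit vector $p$. This avoids rotation invariance of Lebesgue measure.
\<close>

definition std_gaussian :: "'a::euclidean_space measure" where
  "std_gaussian = density lborel (\<lambda>x. \<Prod>b\<in>Basis. ennreal (std_normal_density (x \<bullet> b)))"

lemma space_std_gaussian [simp]: "space std_gaussian = UNIV"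
  and sets_std_gaussian [simp, measurable_cong]: "sets std_gaussian = sets borel"
  by (simp_all add: std_gaussian_def)

text \<open>The product density factors over the coordinates by Tonelli. Total mass, marginals and
  independence are all read off from this one formula.\<close>

lemma emeasure_std_gaussian_box:
  assumes "\<And>b. b \<in> Basis \<Longrightarrow> A b \<in> sets borel"
  shows "emeasure std_gaussian {x::'a::euclidean_space. \<forall>b\<in>Basis. x \<bullet> b \<in> A b} =
    (\<Prod>b\<in>Basis. emeasure (density lborel std_normal_density) (A b))"
proof -
  have [measurable]: "{x::'a. \<forall>b\<in>Basis. x \<bullet> b \<in> A b} \<in> sets borel"
  proof -
    have "{x::'a. \<forall>b\<in>Basis. x \<bullet> b \<in> A b} = (\<Inter>b\<in>Basis. (\<lambda>x. x \<bullet> b) -` A b \<inter> space borel)"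
      by auto
    also have "\<dots> \<in> sets borel"
      using assms by (intro sets.finite_INT measurable_sets[of _ borel borel]) auto
    finally show ?thesis .
  qed
  have ind: "indicator {x::'a. \<forall>b\<in>Basis. x \<bullet> b \<in> A b} x = (\<Prod>b\<in>Basis. indicator (A b) (x \<bullet> b) :: ennreal)" for x
    by (auto simp: indicator_def prod_zero_iff)
  have "emeasure std_gaussian {x::'a. \<forall>b\<in>Basis. x \<bullet> b \<in> A b}
      = (\<integral>\<^sup>+x. (\<Prod>b\<in>Basis. ennreal (std_normal_density (x \<bullet> b)) * indicator (A b) (x \<bullet> b)) \<partial>lborel)"
    unfolding std_gaussian_def by (subst emeasure_density) (auto simp: ind prod.distrib)
  also have "\<dots> = (\<Prod>b\<in>Basis. \<integral>\<^sup>+x. ennreal (std_normal_density x) * indicator (A b) x \<partial>lborel)"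
    using assms by (intro nn_integral_lborel_prod) auto
  also have "\<dots> = (\<Prod>b\<in>Basis. emeasure (density lborel std_normal_density) (A b))"
    using assms by (intro prod.cong) (auto simp: emeasure_density)
  finally show ?thesis .
qed

lemma prob_space_std_gaussian: "prob_space (std_gaussian :: 'a::euclidean_space measure)"
proof
  interpret prob_space "density lborel std_normal_density"
    by (rule prob_space_normal_density) simp
  show "emeasure std_gaussian (space (std_gaussian :: 'a measure)) = 1"
    using emeasure_std_gaussian_box[of "\<lambda>_. UNIV"] emeasure_space_1 by simp
qed

lemma distr_std_gaussian_inner_Basis:
  assumes b: "b \<in> Basis"
  shows "distr std_gaussian borel (\<lambda>x. x \<bullet> b) = density lborel std_normal_density"
proof (rule measure_eqI)
  interpret prob_space "density lborel std_normal_density"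
    by (rule prob_space_normal_density) simp
  fix A assume "A \<in> sets (distr std_gaussian borel (\<lambda>x. x \<bullet> b))"
  then have A[measurable]: "A \<in> sets borel" by simp
  have "{x. \<forall>c\<in>Basis. x \<bullet> c \<in> (if c = b then A else UNIV)} = (\<lambda>x. x \<bullet> b) -` A"
    using b by auto
  then have "emeasure (distr std_gaussian borel (\<lambda>x. x \<bullet> b)) A =
      (\<Prod>c\<in>Basis. emeasure (density lborel std_normal_density) (if c = b then A else UNIV))"
    using emeasure_std_gaussian_box[of "\<lambda>c. if c = b then A else UNIV"]
    by (subst emeasure_distr) auto
  also have "\<dots> = (\<Prod>c\<in>Basis. if c = b then emeasure (density lborel std_normal_density) A else 1)"
    using emeasure_space_1 by (intro prod.cong) auto
  finally show "emeasure (distr std_gaussian borel (\<lambda>x. x \<bullet> b)) A =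
      emeasure (density lborel std_normal_density) A"
    using b by (simp add: prod.delta)
qed simp

text \<open>Independence means that the joint law of the coordinates is the product of their laws,
  which \<open>PiM_eqI\<close> reduces to boxes.\<close>

lemma indep_vars_std_gaussian:
  "prob_space.indep_vars (std_gaussian :: 'a::euclidean_space measure) (\<lambda>_. borel) (\<lambda>b x. x \<bullet> b) Basis"
proof -
  interpret prob_space "std_gaussian :: 'a measure" by (rule prob_space_std_gaussian)
  interpret S: prob_space "density lborel std_normal_density"
    by (rule prob_space_normal_density) simp
  interpret P: product_sigma_finite "\<lambda>_::'a. density lborel (\<lambda>x. ennreal (std_normal_density x))"
    by standard
  have "distr (std_gaussian :: 'a measure) (Pi\<^sub>M Basis (\<lambda>_. borel)) (\<lambda>x. \<lambda>b\<in>Basis. x \<bullet> b) =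
    Pi\<^sub>M Basis (\<lambda>_. density lborel std_normal_density)"
  proof (rule P.PiM_eqI)
    show "sets (distr (std_gaussian :: 'a measure) (Pi\<^sub>M Basis (\<lambda>_. borel)) (\<lambda>x. \<lambda>b\<in>Basis. x \<bullet> b))
        = sets (Pi\<^sub>M Basis (\<lambda>_. density lborel std_normal_density))"
      by (simp only: sets_distr) (intro sets_PiM_cong; simp)
    fix A assume A: "\<And>i::'a. i \<in> Basis \<Longrightarrow> A i \<in> sets (density lborel (\<lambda>x. ennreal (std_normal_density x)))"
    have "(\<lambda>x. \<lambda>b\<in>Basis. x \<bullet> b) -` Pi\<^sub>E Basis A = {x::'a. \<forall>b\<in>Basis. x \<bullet> b \<in> A b}"
      by (auto simp: PiE_iff)
    then show "emeasure (distr (std_gaussian :: 'a measure) (Pi\<^sub>M Basis (\<lambda>_. borel)) (\<lambda>x. \<lambda>b\<in>Basis. x \<bullet> b)) (Pi\<^sub>E Basis A)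
       = (\<Prod>i\<in>Basis. emeasure (density lborel (\<lambda>x. ennreal (std_normal_density x))) (A i))"
      using A emeasure_std_gaussian_box[of A]
      by (subst emeasure_distr) (auto intro!: sets_PiM_I_finite measurable_restrict)
  qed simp
  moreover have "Pi\<^sub>M Basis (\<lambda>i::'a. distr std_gaussian borel (\<lambda>x. x \<bullet> i)) =
      Pi\<^sub>M Basis (\<lambda>_. density lborel std_normal_density)"
    by (intro PiM_cong) (simp_all add: distr_std_gaussian_inner_Basis)
  ultimately show ?thesis
    by (subst indep_vars_iff_distr_eq_PiM') auto
qed

text \<open>A linear combination of independent standard normals is centred normal; its variance is
  the sum of the squared coefficients, here the squared norm of \<open>p\<close>.\<close>

lemma distributed_std_gaussian_inner:
  fixes p :: "'a::euclidean_space"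
  assumes "norm p = 1"
  shows "distributed std_gaussian lborel (\<lambda>x. p \<bullet> x) std_normal_density"
proof -
  interpret prob_space "std_gaussian :: 'a measure" by (rule prob_space_std_gaussian)
  \<comment> \<open>Coordinates with coefficient 0 would contribute degenerate normals, while
    \<open>sum_indep_normal\<close> asks for positive standard deviations.\<close>
  define I where "I = {b\<in>Basis. p \<bullet> b \<noteq> 0}"
  have I: "finite I" "I \<subseteq> Basis" by (auto simp: I_def)
  have "p \<noteq> 0" using assms by auto
  then have "I \<noteq> {}" using euclidean_eq_iff[of p 0] by (auto simp: I_def)
  have sum_I: "(\<Sum>b\<in>I. F b) = (\<Sum>b\<in>Basis. F b)" if "\<And>b. b \<in> Basis \<Longrightarrow> p \<bullet> b = 0 \<Longrightarrow> F b = 0" for F :: "'a \<Rightarrow> real"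
    using that by (intro sum.mono_neutral_left) (auto simp: I_def)
  have "distributed std_gaussian lborel (\<lambda>x. \<Sum>b\<in>I. (p \<bullet> b) * (x \<bullet> b))
      (normal_density (\<Sum>b\<in>I. 0) (sqrt (\<Sum>b\<in>I. \<bar>p \<bullet> b\<bar>\<^sup>2)))"
  proof (rule sum_indep_normal)
    show "indep_vars (\<lambda>i. borel) (\<lambda>b x. (p \<bullet> b) * (x \<bullet> b)) I"
      using indep_vars_subset[OF indep_vars_std_gaussian I(2)]
      by (rule indep_vars_compose2[where Y="\<lambda>b y. (p \<bullet> b) * y"]) simp
    show "distributed std_gaussian lborel (\<lambda>x. (p \<bullet> b) * (x \<bullet> b)) (normal_density 0 \<bar>p \<bullet> b\<bar>)"
      if "b \<in> I" for b
    proof -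
      have "distributed std_gaussian lborel (\<lambda>x. x \<bullet> b) (normal_density 0 1)"
        unfolding distributed_def using distr_std_gaussian_inner_Basis[of b] that I(2)
        by (auto cong: distr_cong)
      from normal_density_affine[OF this, of "p \<bullet> b" 0] show ?thesis
        using that by (auto simp: I_def)
    qed
  qed (use I \<open>I \<noteq> {}\<close> in \<open>auto simp: I_def\<close>)
  moreover have "(\<Sum>b\<in>I. (p \<bullet> b) * (x \<bullet> b)) = p \<bullet> x" for x
    by (subst sum_I) (simp_all add: euclidean_inner[of p x])
  moreover have "(\<Sum>b\<in>I. \<bar>p \<bullet> b\<bar>\<^sup>2) = 1"
    using assms by (subst sum_I) (simp_all add: norm_eq_1 euclidean_inner[of p p] power2_eq_square)
  ultimately show ?thesis by simp
qed

section \<open>Polar coordinates for weights that are constant on rays\<close>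

lemma nn_integral_lborel_scaleR:
  fixes F :: "'a::euclidean_space \<Rightarrow> ennreal"
  assumes [measurable]: "F \<in> borel_measurable borel" and c: "c \<noteq> 0"
  shows "(\<integral>\<^sup>+x. F x \<partial>lborel) = ennreal (\<bar>c\<bar> ^ DIM('a)) * (\<integral>\<^sup>+x. F (c *\<^sub>R x) \<partial>lborel)"
  by (subst lborel_affine[OF c, of 0])
     (simp add: nn_integral_density nn_integral_distr nn_integral_cmult)

text \<open>By scaling, a weight constant on rays gives the ball of radius R exactly R^n times the
  mass of the unit ball. The density on the right is the derivative of that mass, and agreement on
  the half-lines \<open>{..<R}\<close> forces the measures to coincide, so no Jacobian is
  computed.\<close>

lemma distr_norm_density_homogeneous:
  fixes W :: "'a::euclidean_space \<Rightarrow> ennreal"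
  assumes [measurable]: "W \<in> borel_measurable borel"
    and hom: "\<And>c x. c > 0 \<Longrightarrow> W (c *\<^sub>R x) = W x"
    and fin: "(\<integral>\<^sup>+x. W x * indicator (ball 0 1) x \<partial>lborel) < \<infinity>" (is "?A < \<infinity>")
  shows "distr (density lborel W) borel norm =
    density lborel (\<lambda>r. of_nat DIM('a) * ?A * (ennreal (r ^ (DIM('a) - 1)) * indicator {0..} r))"
proof -
  let ?n = "DIM('a)"
  let ?L = "distr (density lborel W) borel norm"
  let ?D = "\<lambda>r. of_nat ?n * ?A * (ennreal (r ^ (?n - 1)) * indicator {0..} r)"
  have n: "?n > 0" by simp
  have L: "emeasure ?L {..<R} = (if R > 0 then ennreal (R ^ ?n) * ?A else 0)" for R
  proof -
    have vim: "norm -` {..<R} = ball (0::'a) R" by auto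
    have "emeasure ?L {..<R} = (\<integral>\<^sup>+x. W x * indicator (ball 0 R) x \<partial>lborel)"
      by (subst emeasure_distr, simp, simp, subst emeasure_density) (auto simp: vim)
    also have "\<dots> = (if R > 0 then ennreal (R ^ ?n) * ?A else 0)"
    proof (cases "R > 0")
      case True
      then have "indicator (ball 0 R) (R *\<^sub>R x) = (indicator (ball 0 1) x :: ennreal)" for x :: 'a
        by (auto simp: indicator_def)
      moreover have "(\<lambda>x. W x * indicator (ball 0 R) x) \<in> borel_measurable borel"
        by (intro borel_measurable_times_ennreal borel_measurable_indicator) auto
      ultimately show ?thesis using True
        by (simp add: nn_integral_lborel_scaleR[of _ R] hom)
    qed (simp add: ball_empty)
    finally show ?thesis .
  qed
  show ?thesis
  \<comment> \<open>\<open>fin\<close> gives the exhausting half-lines finite mass, as uniqueness on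
    a generator demands.\<close>
  proof (rule measure_eqI_generator_eq[where E = "range lessThan" and \<Omega> = UNIV and A = "\<lambda>i. {..<real i}"])
    fix X :: "real set" assume "X \<in> range lessThan"
    then obtain R where X: "X = {..<R}" by auto
    have "emeasure (density lborel ?D) X
        = (\<integral>\<^sup>+r. of_nat ?n * ?A * (ennreal (r ^ (?n - 1)) * indicator {0..R} r) \<partial>lborel)"
      unfolding X
      by (subst emeasure_density)
         (auto intro!: nn_integral_cong_AE eventually_mono[OF AE_lborel_singleton[of R]]
               simp: indicator_def)
    also have "\<dots> = of_nat ?n * ?A * (\<integral>\<^sup>+r. ennreal (r ^ (?n - 1)) * indicator {0..R} r \<partial>lborel)"
      by (subst nn_integral_cmult) auto
    also have "(\<integral>\<^sup>+r. ennreal (r ^ (?n - 1)) * indicator {0..R} r \<partial>lborel) =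
       (if R > 0 then ennreal (R ^ ?n / ?n) else 0)"
    proof (cases "R > 0")
      case True
      have "(\<integral>\<^sup>+r. ennreal (r ^ (?n - 1)) * indicator {0..R} r \<partial>lborel) =
          ennreal (R ^ ?n / ?n - 0 ^ ?n / ?n)"
        using True n
        by (intro nn_integral_FTC_Icc) (auto intro!: derivative_eq_intros)
      then show ?thesis using True by (simp add: zero_power[OF n])
    next
      case False
      have "(\<integral>\<^sup>+r. ennreal (r ^ (?n - 1)) * indicator {0..R} r \<partial>lborel) = (\<integral>\<^sup>+r. 0 \<partial>(lborel :: real measure))"
        using False by (intro nn_integral_cong_AE eventually_mono[OF AE_lborel_singleton[of 0]])
           (auto simp: indicator_def)
      then show ?thesis using False by simp
    qed
    also have "of_nat ?n * ?A * (if R > 0 then ennreal (R ^ ?n / ?n) else 0) =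
        (if R > 0 then ennreal (R ^ ?n) * ?A else 0)"
    proof (cases "R > 0")
      case True
      have "of_nat ?n * ennreal (R ^ ?n / ?n) = ennreal (R ^ ?n)"
        using True n by (simp add: ennreal_of_nat_eq_real_of_nat flip: ennreal_mult)
      then show ?thesis
        using True by (simp add: mult.assoc mult.left_commute[of _ ?A]) (simp add: mult.commute)
    qed simp
    finally show "emeasure ?L X = emeasure
        (density lborel ?D) X"
      using L X by simp
  next
    show "(\<Union>i. {..<real i}) = UNIV"
      using reals_Archimedean2 by (auto simp: set_eq_iff)
    show "emeasure ?L {..<real i} \<noteq> \<infinity>" for i
      using fin by (auto simp: L ennreal_mult_eq_top_iff)
    show "Int_stable (range lessThan :: real set set)"
      unfolding Int_stable_def
    proof safe
      fix a b :: real
      have "{..<a} \<inter> {..<b} = {..<min a b}" by auto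
      then show "{..<a} \<inter> {..<b} \<in> range lessThan" by simp
    qed
  qed (auto simp: borel_Iio)
qed

text \<open>Separates a Gaussian integral into an angular mass and a radial integral, so that the
  angular mass can be solved for.\<close>

lemma nn_integral_polar_homogeneous:
  fixes W :: "'a::euclidean_space \<Rightarrow> ennreal"
  assumes [measurable]: "W \<in> borel_measurable borel" "\<phi> \<in> borel_measurable borel"
    and hom: "\<And>c x. c > 0 \<Longrightarrow> W (c *\<^sub>R x) = W x"
    and fin: "(\<integral>\<^sup>+x. W x * indicator (ball 0 1) x \<partial>lborel) < \<infinity>"
  shows "(\<integral>\<^sup>+x. W x * \<phi> (norm x) \<partial>lborel) =
    of_nat DIM('a) * (\<integral>\<^sup>+x. W x * indicator (ball 0 1) x \<partial>lborel) *
    (\<integral>\<^sup>+r. ennreal (r ^ (DIM('a) - 1)) * \<phi> r * indicator {0..} r \<partial>lborel)"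
    (is "_ = of_nat _ * ?A * _")
proof -
  have H: "distr (density lborel W) borel norm =
      density lborel (\<lambda>r. of_nat DIM('a) * ?A * (ennreal (r ^ (DIM('a) - 1)) * indicator {0..} r))"
    by (intro distr_norm_density_homogeneous hom fin) auto
  have "(\<integral>\<^sup>+x. W x * \<phi> (norm x) \<partial>lborel) = (\<integral>\<^sup>+r. \<phi> r \<partial>distr (density lborel W) borel norm)"
    by (simp add: nn_integral_distr nn_integral_density)
  also have "\<dots> = of_nat DIM('a) * ?A *
    (\<integral>\<^sup>+r. ennreal (r ^ (DIM('a) - 1)) * \<phi> r * indicator {0..} r \<partial>lborel)"
    unfolding H
    by (simp add: nn_integral_density mult.assoc nn_integral_cmult mult.commute[of "indicator _ _"])
  finally show ?thesis .
qed

section \<open>The cone measure on the sphere\<close>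

lemma nn_integral_sphere_surface_measure:
  fixes F :: "'a::euclidean_space \<Rightarrow> ennreal"
  assumes [measurable]: "F \<in> borel_measurable borel"
  shows "(\<integral>\<^sup>+\<theta>. F \<theta> \<partial>sphere_surface_measure) =
    of_nat DIM('a) * (\<integral>\<^sup>+x. F (x /\<^sub>R norm x) * indicator (ball 0 1) x \<partial>lborel)"
  unfolding sphere_surface_measure_def
  by (subst nn_integral_scale_measure, simp, subst nn_integral_distr)
     (simp_all add: nn_integral_restrict_space measurable_restrict_space1)

lemma sets_sphere_surface_measure [simp, measurable_cong]:
  "sets sphere_surface_measure = sets borel"
  and space_sphere_surface_measure [simp]: "space sphere_surface_measure = UNIV"
  by (simp_all add: sphere_surface_measure_def space_scale_measure)

lemma finite_measure_sphere_surface_measure: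
  "finite_measure (sphere_surface_measure :: 'a::euclidean_space measure)"
proof
  show "emeasure sphere_surface_measure (space (sphere_surface_measure :: 'a measure)) \<noteq> \<infinity>"
    using nn_integral_sphere_surface_measure[of "\<lambda>_::'a. 1"] emeasure_lborel_ball_finite[of "0::'a" 1]
    by (simp add: ennreal_mult_eq_top_iff less_top[symmetric] del: space_sphere_surface_measure)
qed

lemma AE_sphere_surface_measure: "AE \<theta> in sphere_surface_measure. norm (\<theta>::'a::euclidean_space) = 1"
proof (rule AE_I)
  have "emeasure sphere_surface_measure {\<theta>::'a. norm \<theta> \<noteq> 1} =
      (\<integral>\<^sup>+\<theta>. indicator {\<theta>::'a. norm \<theta> \<noteq> 1} \<theta> \<partial>sphere_surface_measure)"
    by simp
  also have "\<dots> = of_nat DIM('a) *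
      (\<integral>\<^sup>+x. indicator {\<theta>::'a. norm \<theta> \<noteq> 1} (x /\<^sub>R norm x) * indicator (ball 0 1) x \<partial>lborel)"
    by (rule nn_integral_sphere_surface_measure) simp
  also have "(\<integral>\<^sup>+x. indicator {\<theta>::'a. norm \<theta> \<noteq> 1} (x /\<^sub>R norm x) * indicator (ball 0 1) x \<partial>lborel) =
      (\<integral>\<^sup>+x. 0 \<partial>(lborel :: 'a measure))"
    \<comment> \<open>On the ball the normalised vector has norm 1 except at the origin, where
      division by zero makes it 0; a single point is null.\<close>
    by (intro nn_integral_cong_AE eventually_mono[OF AE_lborel_singleton[of 0]]) (auto simp: indicator_def)
  finally show "emeasure sphere_surface_measure {\<theta>::'a. norm \<theta> \<noteq> 1} = 0" by simp
qed auto

text \<open>The coordinate form of the density yields the law of \<open>p \<bullet> x\<close>; this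
  radial form is what the polar formula accepts.\<close>

lemma std_gaussian_eq_exp_norm:
  "std_gaussian = density lborel (\<lambda>x::'a::euclidean_space.
     ennreal (sqrt (2 * pi) powi (- int DIM('a)) * exp (- (norm x)\<^sup>2 / 2)))"
proof -
  have "(\<Prod>b\<in>Basis. ennreal (std_normal_density (x \<bullet> b))) =
      ennreal (sqrt (2 * pi) powi (- int DIM('a)) * exp (- (norm x)\<^sup>2 / 2))" for x :: 'a
  proof -
    have "(\<Prod>b\<in>Basis. std_normal_density (x \<bullet> b)) =
        (1 / sqrt (2 * pi)) ^ DIM('a) * exp (\<Sum>b\<in>Basis. - (x \<bullet> b)\<^sup>2 / 2)"
      by (simp add: std_normal_density_def prod_dividef exp_sum power_one_over)
    also have "(\<Sum>b\<in>Basis. - (x \<bullet> b)\<^sup>2 / 2) = - (norm x)\<^sup>2 / 2"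
      unfolding power2_norm_eq_inner euclidean_inner[of x x]
      by (simp add: sum_negf sum_divide_distrib power2_eq_square)
    finally have "(\<Prod>b\<in>Basis. std_normal_density (x \<bullet> b)) =
        sqrt (2 * pi) powi (- int DIM('a)) * exp (- (norm x)\<^sup>2 / 2)"
      by (simp add: power_int_minus power_one_over field_simps)
    then show ?thesis
      by (simp add: prod_ennreal)
  qed
  then show ?thesis unfolding std_gaussian_def by simp
qed

section \<open>Moments of a linear form on the sphere, and the matching beta integrals\<close>

lemma nn_integral_std_normal_moment_even_half:
  "(\<integral>\<^sup>+x. ennreal (std_normal_density x * x ^ (2 * m)) * indicator {0..} x \<partial>lborel) =
    ennreal (fact (2 * m) / (2 ^ m * fact m) / 2)"
proof -
  let ?F = "\<lambda>x. ennreal (std_normal_density x * x ^ (2 * m))"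
  let ?I = "\<integral>\<^sup>+x. ?F x * indicator {0..} x \<partial>lborel"
  have "ennreal (fact (2 * m) / (2 ^ m * fact m)) = (\<integral>\<^sup>+x. ?F x \<partial>lborel)"
    using std_normal_moment_even[of m]
    by (subst nn_integral_eq_integral) (auto simp: has_bochner_integral_iff zero_le_even_power)
  also have "\<dots> = (\<integral>\<^sup>+x. ?F x * indicator {0..} x + ?F x * indicator {..0} x \<partial>lborel)"
    by (intro nn_integral_cong_AE eventually_mono[OF AE_lborel_singleton[of 0]])
       (auto simp: indicator_def)
  also have "\<dots> = ?I + (\<integral>\<^sup>+x. ?F x * indicator {..0} x \<partial>lborel)"
    by (subst nn_integral_add) auto
  also have "(\<integral>\<^sup>+x. ?F x * indicator {..0} x \<partial>lborel) = ?I"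
    by (subst nn_integral_real_affine[of _ "-1" 0])
       (auto simp: std_normal_density_def indicator_def intro!: nn_integral_cong)
  finally have "ennreal (fact (2 * m) / (2 ^ m * fact m)) = 2 * ?I"
    by (simp add: mult_2)
  then have "ennreal (1/2) * ennreal (fact (2 * m) / (2 ^ m * fact m)) = (ennreal (1/2) * ennreal 2) * ?I"
    by (simp add: mult.assoc)
  also have "ennreal (1/2) * ennreal 2 = 1"
    by (subst ennreal_mult[symmetric]) auto
  finally show ?thesis
    by (subst (asm) ennreal_mult[symmetric]) (auto simp: mult_ac)
qed

text \<open>The moment of order 2i of \<open>p \<bullet> X\<close> is computed twice: directly, as
  (2i)!/(2^i i!), and in polar coordinates, as the angular integral times a radial one. As n - 1 =
  2k + 2 is even, the radial integral is itself half of an even normal moment, of order 2(k+1+i), so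
  only factorials and powers of 2 and pi appear.\<close>

lemma nn_integral_sphere_inner_power_even:
  fixes p :: "'a::euclidean_space"
  assumes p: "norm p = 1" and n: "DIM('a) = 2 * k + 3"
  shows "(\<integral>\<^sup>+\<theta>. ennreal ((p \<bullet> \<theta>) ^ (2 * i)) \<partial>sphere_surface_measure) =
    ennreal (2 * (4 * pi) ^ (k + 1) * (fact (2 * i) * fact (k + 1 + i) / (fact i * fact (2 * (k + 1 + i)))))"
proof -
  let ?m = "k + 1 + i"
  let ?c = "sqrt (2 * pi) powi (- int DIM('a))"
  let ?M = "\<lambda>m. fact (2 * m) / (2 ^ m * fact m) :: real"
  \<comment> \<open>\<open>W\<close> is the integrand on the sphere, extended to be constant on
    rays. The Gaussian integrand is then \<open>W x * \<phi> (norm x)\<close>, and the sphere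
    integral is n times \<open>A\<close>.\<close>
  define W where "W = (\<lambda>x::'a. ennreal ((p \<bullet> (x /\<^sub>R norm x)) ^ (2 * i)))"
  define A where "A = (\<integral>\<^sup>+x. W x * indicator (ball 0 1) x \<partial>lborel)"
  define \<phi> where "\<phi> = (\<lambda>r. ennreal (r ^ (2 * i) * (?c * exp (- r\<^sup>2 / 2))))"
  have [measurable]: "W \<in> borel_measurable borel" "\<phi> \<in> borel_measurable borel"
    unfolding W_def \<phi>_def by measurable
  have sphere: "(\<integral>\<^sup>+\<theta>. ennreal ((p \<bullet> \<theta>) ^ (2 * i)) \<partial>sphere_surface_measure) = of_nat DIM('a) * A"
    unfolding A_def W_def by (rule nn_integral_sphere_surface_measure) simp
  have W_le: "W x \<le> 1" for x
  proof -
    have "\<bar>p \<bullet> (x /\<^sub>R norm x)\<bar> \<le> norm p * norm (x /\<^sub>R norm x)"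
      by (rule Cauchy_Schwarz_ineq2)
    also have "\<dots> \<le> 1" using p by (cases "x = 0") auto
    finally have "\<bar>p \<bullet> (x /\<^sub>R norm x)\<bar> ^ (2 * i) \<le> 1" by (intro power_le_one) auto
    then show ?thesis unfolding W_def by (simp add: power_even_abs)
  qed
  have "A \<le> (\<integral>\<^sup>+x. indicator (ball 0 1) x \<partial>(lborel :: 'a measure))"
    unfolding A_def using W_le by (intro nn_integral_mono) (auto simp: indicator_def)
  also have "\<dots> < \<infinity>" using emeasure_lborel_ball_finite[of "0::'a" 1] by simp
  finally have fin: "A < \<infinity>" .
  have hom: "W (c *\<^sub>R x) = W x" if "c > 0" for c x
    using that by (simp add: W_def field_simps)
  have "ennreal (?M i) = (\<integral>\<^sup>+y. ennreal (std_normal_density y * y ^ (2 * i)) \<partial>lborel)"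
    using std_normal_moment_even[of i]
    by (subst nn_integral_eq_integral) (auto simp: has_bochner_integral_iff zero_le_even_power)
  also have "\<dots> = (\<integral>\<^sup>+y. ennreal (std_normal_density y) * ennreal (y ^ (2 * i)) \<partial>lborel)"
    by (simp add: ennreal_mult)
  also have "\<dots> = (\<integral>\<^sup>+x. ennreal ((p \<bullet> x) ^ (2 * i)) \<partial>std_gaussian)"
    by (rule distributed_nn_integral[OF distributed_std_gaussian_inner[OF p]]) simp
  also have "\<dots> = (\<integral>\<^sup>+x. ennreal (?c * exp (- (norm x)\<^sup>2 / 2)) * ennreal ((p \<bullet> x) ^ (2 * i)) \<partial>lborel)"
    unfolding std_gaussian_eq_exp_norm by (subst nn_integral_density) auto
  also have "\<dots> = (\<integral>\<^sup>+x. W x * \<phi> (norm x) \<partial>lborel)"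
  proof (rule nn_integral_cong)
    fix x :: 'a
    have "(p \<bullet> x) ^ (2 * i) = (p \<bullet> (x /\<^sub>R norm x)) ^ (2 * i) * norm x ^ (2 * i)"
      by (cases "x = 0"; cases "i = 0") (simp_all add: field_simps)
    moreover have "ennreal (c * e) * ennreal (y * r) = ennreal y * ennreal (r * (c * e))"
      if "c \<ge> 0" "e \<ge> 0" "y \<ge> 0" "r \<ge> 0" for c e y r :: real
      using that by (simp add: ennreal_mult mult_ac)
    ultimately show "ennreal (?c * exp (- (norm x)\<^sup>2 / 2)) * ennreal ((p \<bullet> x) ^ (2 * i)) = W x * \<phi> (norm x)"
      unfolding W_def \<phi>_def by (simp only:) (simp add: zero_le_even_power)
  qed
  also have "\<dots> = of_nat DIM('a) * A * (\<integral>\<^sup>+r. ennreal (r ^ (DIM('a) - 1)) * \<phi> r * indicator {0..} r \<partial>lborel)"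
    unfolding A_def by (intro nn_integral_polar_homogeneous hom fin[unfolded A_def]) auto
  also have "(\<integral>\<^sup>+r. ennreal (r ^ (DIM('a) - 1)) * \<phi> r * indicator {0..} r \<partial>lborel) =
      (\<integral>\<^sup>+r. ennreal (1 / (2 * pi) ^ (k + 1)) * (ennreal (std_normal_density r * r ^ (2 * ?m)) * indicator {0..} r) \<partial>lborel)"
  proof (rule nn_integral_cong)
    fix r :: real
    \<comment> \<open>One of the 2k + 3 factors goes into the one-dimensional normal density; the
      even number left over makes (2 pi)^(k+1).\<close>
    have "sqrt (2 * pi) ^ (2 * k + 3) = sqrt (2 * pi) * (sqrt (2 * pi))\<^sup>2 ^ (k + 1)"
      unfolding power_mult[symmetric] power_Suc[symmetric] by (simp add: eval_nat_numeral)
    also have "(sqrt (2 * pi))\<^sup>2 = 2 * pi" by simp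
    finally have c: "?c = 1 / sqrt (2 * pi) * (1 / (2 * pi) ^ (k + 1))"
      unfolding n power_int_minus power_int_of_nat by (simp only: inverse_mult_distrib inverse_eq_divide times_divide_times_eq mult_1)
    have "r ^ (DIM('a) - 1) * (r ^ (2 * i) * (?c * exp (- r\<^sup>2 / 2))) =
        1 / (2 * pi) ^ (k + 1) * (std_normal_density r * r ^ (2 * ?m))"
    proof -
      have "r ^ (DIM('a) - 1) * r ^ (2 * i) = r ^ (2 * ?m)"
        unfolding n by (simp flip: power_add add: algebra_simps)
      then show ?thesis
        unfolding c std_normal_density_def by (simp only: mult.assoc[symmetric]) (simp only: mult_ac)
    qed
    moreover have "?c \<ge> 0" by (simp add: zero_le_power_int)
    ultimately show "ennreal (r ^ (DIM('a) - 1)) * \<phi> r * indicator {0..} r =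
        ennreal (1 / (2 * pi) ^ (k + 1)) * (ennreal (std_normal_density r * r ^ (2 * ?m)) * indicator {0..} r)"
      unfolding \<phi>_def by (auto simp: indicator_def ennreal_mult[symmetric] simp del: power_Suc)
  qed
  also have "\<dots> = ennreal (1 / (2 * pi) ^ (k + 1)) * ennreal (?M ?m / 2)"
    by (subst nn_integral_cmult) (simp_all only: nn_integral_std_normal_moment_even_half, measurable)
  also have "\<dots> = ennreal (?M ?m / (2 * (2 * pi) ^ (k + 1)))"
    by (subst ennreal_mult[symmetric]) (simp_all add: mult_ac)
  finally have eq: "ennreal (?M i) = of_nat DIM('a) * A * ennreal (?M ?m / (2 * (2 * pi) ^ (k + 1)))" .
  \<comment> \<open>In \<open>ennreal\<close> the radial factor is removed by multiplying with its
    reciprocal, which is possible as it is positive and finite.\<close>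
  let ?K = "?M ?m / (2 * (2 * pi) ^ (k + 1))"
  have K: "?K > 0" by simp
  have "of_nat DIM('a) * A = of_nat DIM('a) * A * (ennreal ?K * ennreal (1 / ?K))"
    using K by (subst ennreal_mult[symmetric]) auto
  also have "\<dots> = ennreal (?M i) * ennreal (1 / ?K)"
    unfolding eq by (simp only: mult.assoc)
  also have "\<dots> = ennreal (?M i * (1 / ?K))"
    by (rule ennreal_mult[symmetric]) auto
  also have "?M i * (1 / ?K) = 2 * (4 * pi) ^ (k + 1) * (fact (2 * i) * fact (k + 1 + i) / (fact i * fact (2 * (k + 1 + i))))"
  proof -
    have "(4 * pi) ^ (k + 1) * 2 ^ i = (2 * pi) ^ (k + 1) * (2 ^ ?m :: real)"
      by (simp add: power_add power_mult_distrib) (simp add: power_mult_distrib[symmetric])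
    then show ?thesis by (simp add: field_simps del: power_Suc fact_Suc mult_Suc_right)
  qed
  finally show ?thesis using sphere by simp
qed

text \<open>The beta integral B(i + 1/2, k + 1) in factorials. The bracket keeps the shape it has in
  \<open>nn_integral_sphere_inner_power_even\<close>, so the two can be compared without simplifying
  it. The induction trades a factor 1 - s^2 for a higher power of s, hence the arbitrary
  \<open>i\<close>.\<close>

lemma has_integral_beta_even:
  "((\<lambda>s::real. s ^ (2 * i) * (1 - s\<^sup>2) ^ k) has_integral
     (fact k * 4 ^ (k + 1) * (fact (2 * i) * fact (k + 1 + i) / (fact i * fact (2 * (k + 1 + i)))))) {-1..1}"
proof (induction k arbitrary: i)
  case 0
  have "((\<lambda>s::real. s ^ (2 * i)) has_integral (1 ^ (2 * i + 1) / real (2 * i + 1) - (-1) ^ (2 * i + 1) / real (2 * i + 1))) {-1..1}"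
  proof (intro fundamental_theorem_of_calculus)
    fix s :: real
    have "((\<lambda>s. s ^ (2 * i + 1) / real (2 * i + 1)) has_real_derivative
        real (2 * i + 1) * s ^ (2 * i + 1 - Suc 0) / real (2 * i + 1)) (at s within {-1..1})"
      by (intro DERIV_cdivide DERIV_pow)
    then show "((\<lambda>s. s ^ (2 * i + 1) / real (2 * i + 1)) has_vector_derivative s ^ (2 * i)) (at s within {-1..1})"
      by (simp add: has_real_derivative_iff_has_vector_derivative)
  qed simp
  moreover have "1 ^ (2 * i + 1) / real (2 * i + 1) - (-1) ^ (2 * i + 1) / real (2 * i + 1) =
     fact 0 * 4 ^ (0 + 1) * (fact (2 * i) * fact (0 + 1 + i) / (fact i * fact (2 * (0 + 1 + i))))"
  proof -
    have 1: "fact (2 * (0 + 1 + i)) = (2 * real i + 2) * (2 * real i + 1) * fact (2 * i)"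
      "fact (0 + 1 + i) = (real i + 1) * (fact i :: real)"
      by (simp_all add: algebra_simps)
    have "real i + 1 > 0" by simp
    then show ?thesis unfolding 1
      by (simp add: divide_simps) (simp add: algebra_simps)?
  qed
  ultimately show ?case by simp
next
  case (Suc k)
  let ?S = "fact k * 4 ^ (k + 1) * (fact (2 * Suc i) * fact (k + 1 + Suc i) / (fact (Suc i) * fact (2 * (k + 1 + Suc i)))) :: real"
  \<comment> \<open>Integration by parts: this is the derivative of
    \<open>s ^ (2*i+1) * (1 - s^2) ^ Suc k\<close>, which vanishes at both ends.\<close>
  have "((\<lambda>s::real. real (2 * i + 1) * s ^ (2 * i) * (1 - s\<^sup>2) ^ Suc k
            + s ^ (2 * i + 1) * (real (Suc k) * (1 - s\<^sup>2) ^ k * (- 2 * s)))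
       has_integral (1 ^ (2 * i + 1) * (1 - 1\<^sup>2) ^ Suc k - (-1) ^ (2 * i + 1) * (1 - (-1)\<^sup>2) ^ Suc k)) {-1..1}"
  proof (intro fundamental_theorem_of_calculus)
    fix s :: real
    have "((\<lambda>s. s ^ (2 * i + 1) * (1 - s\<^sup>2) ^ Suc k) has_real_derivative
        s ^ (2 * i + 1) * (real (Suc k) * ((0 - real 2 * s ^ (2 - Suc 0)) * (1 - s\<^sup>2) ^ (Suc k - Suc 0)))
        + real (2 * i + 1) * s ^ (2 * i + 1 - Suc 0) * (1 - s\<^sup>2) ^ Suc k) (at s within {-1..1})"
      by (intro DERIV_mult' DERIV_power DERIV_diff DERIV_const DERIV_pow)
    then show "((\<lambda>s. s ^ (2 * i + 1) * (1 - s\<^sup>2) ^ Suc k) has_vector_derivative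
        real (2 * i + 1) * s ^ (2 * i) * (1 - s\<^sup>2) ^ Suc k
            + s ^ (2 * i + 1) * (real (Suc k) * (1 - s\<^sup>2) ^ k * (- 2 * s))) (at s within {-1..1})"
      unfolding has_real_derivative_iff_has_vector_derivative
      by (rule has_vector_derivative_eq_rhs) (simp add: algebra_simps)
  qed simp
  then have "((\<lambda>s::real. real (2 * i + 1) * s ^ (2 * i) * (1 - s\<^sup>2) ^ Suc k
            + s ^ (2 * i + 1) * (real (Suc k) * (1 - s\<^sup>2) ^ k * (- 2 * s))) has_integral 0) {-1..1}"
    by simp
  \<comment> \<open>Adding 2(k+1) times the hypothesis at \<open>Suc i\<close> cancels the summand
    that came from differentiating the power of 1 - s^2.\<close>
  from has_integral_add[OF this has_integral_mult_right[OF Suc.IH[of "Suc i"], of "2 * real (Suc k)"]]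
  have "((\<lambda>s::real. real (2 * i + 1) * (s ^ (2 * i) * (1 - s\<^sup>2) ^ Suc k)) has_integral (2 * real (Suc k) * ?S)) {-1..1}"
    by (rule has_integral_eq_rhs[OF has_integral_eq[rotated]])
       (simp_all add: algebra_simps power2_eq_square)
  from has_integral_divide[OF this, of "real (2 * i + 1)"]
  have "((\<lambda>s::real. s ^ (2 * i) * (1 - s\<^sup>2) ^ Suc k) has_integral (2 * real (Suc k) * ?S / real (2 * i + 1))) {-1..1}"
    by simp
  moreover have "2 * real (Suc k) * ?S / real (2 * i + 1) =
    fact (Suc k) * 4 ^ (Suc k + 1) * (fact (2 * i) * fact (Suc k + 1 + i) / (fact i * fact (2 * (Suc k + 1 + i))))"
  proof -
    have 1: "fact (2 * Suc i) = (2 * real i + 2) * (2 * real i + 1) * fact (2 * i)"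
      "fact (Suc i) = (real i + 1) * (fact i :: real)" "fact (Suc k) = (real k + 1) * (fact k :: real)"
      by (simp_all add: algebra_simps)
    have 2: "k + 1 + Suc i = Suc k + 1 + i" by simp
    have "real i + 1 > 0" by simp
    then show ?thesis unfolding 1 2
      by (simp add: divide_simps del: fact_Suc mult_Suc_right) (simp add: algebra_simps)?
  qed
  ultimately show ?case by simp
qed

lemma has_integral_beta_odd:
  "((\<lambda>s::real. s ^ (2 * i + 1) * (1 - s\<^sup>2) ^ k) has_integral 0) {-1..1}"
proof -
  let ?f = "\<lambda>s::real. s ^ (2 * i + 1) * (1 - s\<^sup>2) ^ k"
  have "?f integrable_on {-1..1}"
    by (intro integrable_continuous_interval continuous_intros)
  moreover have "integral {-1..1} ?f = - integral {-1..1} ?f"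
    using Henstock_Kurzweil_Integration.integral_reflect_real[of 1 "-1" ?f] by simp
  ultimately show ?thesis by (simp add: has_integral_iff)
qed

lemma integral_sphere_surface_measure:
  fixes F :: "'a::euclidean_space \<Rightarrow> real"
  assumes [measurable]: "F \<in> borel_measurable borel"
  shows "(\<integral>\<theta>. F \<theta> \<partial>sphere_surface_measure) =
    DIM('a) * (\<integral>x. indicator (ball 0 1) x *\<^sub>R F (x /\<^sub>R norm x) \<partial>lborel)"
proof -
  \<comment> \<open>As a constant density, the scaling becomes accessible to
    \<open>integral_density\<close>.\<close>
  have eq: "(sphere_surface_measure :: 'a measure) =
      density (distr (restrict_space lborel (ball 0 1)) borel (\<lambda>x. x /\<^sub>R norm x)) (\<lambda>_. ennreal (real DIM('a)))"
    by (rule measure_eqI)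
       (simp_all add: sphere_surface_measure_def emeasure_density_const ennreal_of_nat_eq_real_of_nat)
  have [measurable]: "(\<lambda>x::'a. x /\<^sub>R norm x) \<in> borel_measurable (restrict_space lborel (ball 0 1))"
    by (rule measurable_restrict_space1) simp
  show ?thesis
    unfolding eq by (subst integral_density) (simp_all add: integral_distr integral_restrict_space)
qed

lemma lborel_distr_uminus_euclidean: "distr lborel borel uminus = (lborel :: 'a::euclidean_space measure)"
  using lborel_affine[of "-1" "0::'a"] by (simp add: density_1)

text \<open>The reflection of x to -x preserves Lebesgue measure and the ball and changes the sign
  of the integrand.\<close>

lemma integral_sphere_inner_power_odd:
  "(\<integral>\<theta>. (p \<bullet> \<theta>) ^ (2 * i + 1) \<partial>sphere_surface_measure) = 0" for p :: "'a::euclidean_space"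
proof -
  let ?F = "\<lambda>x. indicator (ball 0 1) x *\<^sub>R (p \<bullet> (x /\<^sub>R norm x)) ^ (2 * i + 1)"
  have [measurable]: "?F \<in> borel_measurable borel" by (intro borel_measurable_scaleR borel_measurable_indicator) auto
  have "(\<integral>x. ?F x \<partial>lborel) = (\<integral>x. ?F x \<partial>distr lborel borel uminus)"
    by (simp only: lborel_distr_uminus_euclidean)
  also have "\<dots> = (\<integral>x. ?F (- x) \<partial>lborel)"
    by (rule integral_distr) (simp, fact)
  also have "\<dots> = (\<integral>x. - ?F x \<partial>lborel)"
    by (intro Bochner_Integration.integral_cong) (auto simp: indicator_def)
  also have "\<dots> = - (\<integral>x. ?F x \<partial>lborel)"
    by (rule Bochner_Integration.integral_minus)
  finally have "(\<integral>x. ?F x \<partial>lborel) = 0" by simp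
  then show ?thesis by (subst integral_sphere_surface_measure) auto
qed

section \<open>From powers to continuous functions\<close>

lemma sphere_area_odd: "sphere_area (2 * k + 1) = 2 * pi ^ (k + 1) / fact k"
proof -
  have "real (2 * k + 1 + 1) / 2 = real (k + 1)" by simp
  then show ?thesis
    unfolding sphere_area_def by (simp only: powr_realpow[OF pi_gt_zero]) (simp add: Gamma_fact)
qed

text \<open>Almost everywhere \<open>p \<bullet> \<theta>\<close> lies in [-1, 1], where
  \<open>G\<close> is bounded, and the measure is finite.\<close>

lemma integrable_sphere_continuous_inner:
  fixes p :: "'a::euclidean_space"
  assumes p: "norm p = 1" and G: "continuous_on UNIV (G :: real \<Rightarrow> real)"
  shows "integrable sphere_surface_measure (\<lambda>\<theta>. G (p \<bullet> \<theta>))"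
proof -
  interpret finite_measure "sphere_surface_measure :: 'a measure"
    by (rule finite_measure_sphere_surface_measure)
  have [measurable]: "G \<in> borel_measurable borel"
    using G by (rule borel_measurable_continuous_onI)
  have "bounded (G ` {-1..1})"
    by (intro compact_imp_bounded compact_continuous_image continuous_on_subset[OF G]) auto
  then obtain B where "\<forall>y\<in>G ` {-1..1}. norm y \<le> B"
    using bounded_iff by blast
  then have B: "norm (G s) \<le> B" if "s \<in> {-1..1}" for s
    using that by blast
  show ?thesis
  proof (rule integrable_const_bound)
    show "AE \<theta> in sphere_surface_measure. norm (G (p \<bullet> \<theta>)) \<le> B"
      using AE_sphere_surface_measure
    proof eventually_elim
      fix \<theta> :: 'a assume "norm \<theta> = 1"
      then have "\<bar>p \<bullet> \<theta>\<bar> \<le> 1" using Cauchy_Schwarz_ineq2[of p \<theta>] p by simp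
      then show "norm (G (p \<bullet> \<theta>)) \<le> B" by (intro B) auto
    qed
  qed simp
qed

lemma integral_sphere_inner_power:
  fixes p :: "'a::euclidean_space"
  assumes p: "norm p = 1" and n: "DIM('a) = 2 * k + 3"
  shows "(\<integral>\<theta>. (p \<bullet> \<theta>) ^ j \<partial>sphere_surface_measure) =
    sphere_area (2 * k + 1) * integral {-1..1} (\<lambda>s. s ^ j * (1 - s\<^sup>2) ^ k)"
proof (cases "even j")
  case True
  then obtain i where j: "j = 2 * i" by blast
  have "(\<integral>\<theta>. (p \<bullet> \<theta>) ^ (2 * i) \<partial>sphere_surface_measure) =
     2 * (4 * pi) ^ (k + 1) * (fact (2 * i) * fact (k + 1 + i) / (fact i * fact (2 * (k + 1 + i))))"
    by (rule integral_eq_nn_integral[THEN trans])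
       (auto simp: nn_integral_sphere_inner_power_even[OF p n] zero_le_even_power)
  \<comment> \<open>Both sides carry the same factorial bracket, and 2 pi^(k+1)/k! times k! 4^(k+1)
    is the prefactor 2 (4 pi)^(k+1).\<close>
  then show ?thesis
    unfolding j sphere_area_odd integral_unique[OF has_integral_beta_even]
    by (simp add: power_mult_distrib mult_ac)
next
  case False
  then obtain i where j: "j = 2 * i + 1" by (blast elim: oddE)
  show ?thesis
    unfolding j integral_sphere_inner_power_odd integral_unique[OF has_integral_beta_odd] by simp
qed

text \<open>Both sides are linear in \<open>G\<close> and controlled by its supremum on [-1, 1].
  They agree on powers, hence on polynomials, and Stone-Weierstrass extends this to continuous
  \<open>G\<close>.\<close>

lemma Funk_Hecke:
  fixes p :: "'a::euclidean_space"
  assumes p: "norm p = 1" and n: "DIM('a) = 2 * k + 3" and G: "continuous_on UNIV (G :: real \<Rightarrow> real)"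
  shows "(\<integral>\<theta>. G (p \<bullet> \<theta>) \<partial>sphere_surface_measure) =
    sphere_area (2 * k + 1) * integral {-1..1} (\<lambda>s. G s * (1 - s\<^sup>2) ^ k)"
proof -
  let ?\<sigma> = "sphere_surface_measure :: 'a measure"
  let ?w = "sphere_area (2 * k + 1)"
  interpret finite_measure ?\<sigma> by (rule finite_measure_sphere_surface_measure)
  define L where "L G = (\<integral>\<theta>. G (p \<bullet> \<theta>) \<partial>?\<sigma>) - ?w * integral {-1..1} (\<lambda>s. G s * (1 - s\<^sup>2) ^ k)" for G
  have w: "?w > 0" unfolding sphere_area_odd by simp
  have int: "(\<lambda>s. Q s * (1 - s\<^sup>2) ^ k) integrable_on {-1..1}" if "continuous_on UNIV Q" for Q :: "real \<Rightarrow> real"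
    by (intro integrable_continuous_interval continuous_intros continuous_on_subset[OF that]) auto
  have L_poly: "L (\<lambda>s. \<Sum>j\<le>N. a j * s ^ j) = 0" for a N
  proof -
    have "(\<integral>\<theta>. (\<Sum>j\<le>N. a j * (p \<bullet> \<theta>) ^ j) \<partial>?\<sigma>) = (\<Sum>j\<le>N. a j * (\<integral>\<theta>. (p \<bullet> \<theta>) ^ j \<partial>?\<sigma>))"
      by (subst Bochner_Integration.integral_sum)
         (auto intro!: integrable_mult_right integrable_sphere_continuous_inner[OF p, of "\<lambda>s. s ^ _"] continuous_intros)
    moreover have "integral {-1..1} (\<lambda>s. (\<Sum>j\<le>N. a j * s ^ j) * (1 - s\<^sup>2) ^ k) =
        (\<Sum>j\<le>N. a j * integral {-1..1} (\<lambda>s. s ^ j * (1 - s\<^sup>2) ^ k))"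
      unfolding sum_distrib_right mult.assoc
      by (subst Henstock_Kurzweil_Integration.integral_sum)
         (auto intro!: integrable_on_mult_right int continuous_intros)
    ultimately show ?thesis
      unfolding L_def integral_sphere_inner_power[OF p n] by (simp add: sum_distrib_left mult_ac)
  qed
  \<comment> \<open>A bound for the functional \<open>L\<close> in the supremum norm: the mass of
    the sphere, plus \<open>?w\<close> times the length 2 of [-1, 1], where the power of 1 - s^2 is
    at most 1.\<close>
  define C where "C = measure ?\<sigma> UNIV + 2 * ?w"
  have bound: "\<bar>L G\<bar> \<le> e * C" if e: "e > 0" for e
  proof -
    obtain Q where Q: "real_polynomial_function Q" "\<And>s. s \<in> {-1..1} \<Longrightarrow> \<bar>G s - Q s\<bar> < e"
      using Stone_Weierstrass_real_polynomial_function[of "{-1..1}" G e] continuous_on_subset[OF G] e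
      by auto
    obtain a N where QN: "Q = (\<lambda>s. \<Sum>j\<le>N. a j * s ^ j)"
      using Q(1) real_polynomial_function_iff_sum by auto
    have Qc: "continuous_on UNIV Q" unfolding QN by (intro continuous_intros)
    have intG: "integrable ?\<sigma> (\<lambda>\<theta>. G (p \<bullet> \<theta>))" and intQ: "integrable ?\<sigma> (\<lambda>\<theta>. Q (p \<bullet> \<theta>))"
      using integrable_sphere_continuous_inner[OF p] G Qc by blast+
    have "\<bar>(\<integral>\<theta>. G (p \<bullet> \<theta>) \<partial>?\<sigma>) - (\<integral>\<theta>. Q (p \<bullet> \<theta>) \<partial>?\<sigma>)\<bar> = \<bar>\<integral>\<theta>. G (p \<bullet> \<theta>) - Q (p \<bullet> \<theta>) \<partial>?\<sigma>\<bar>"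
      using intG intQ by simp
    also have "\<dots> \<le> (\<integral>\<theta>. \<bar>G (p \<bullet> \<theta>) - Q (p \<bullet> \<theta>)\<bar> \<partial>?\<sigma>)"
      by (rule integral_abs_bound)
    also have "\<dots> \<le> (\<integral>\<theta>. e \<partial>?\<sigma>)"
    proof (rule integral_mono_AE)
      show "AE \<theta> in ?\<sigma>. \<bar>G (p \<bullet> \<theta>) - Q (p \<bullet> \<theta>)\<bar> \<le> e"
        using AE_sphere_surface_measure
      proof eventually_elim
        fix \<theta> :: 'a assume "norm \<theta> = 1"
        then have "\<bar>p \<bullet> \<theta>\<bar> \<le> 1" using Cauchy_Schwarz_ineq2[of p \<theta>] p by simp
        then show "\<bar>G (p \<bullet> \<theta>) - Q (p \<bullet> \<theta>)\<bar> \<le> e" by (intro less_imp_le Q(2)) auto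
      qed
    qed (use intG intQ in auto)
    also have "\<dots> = e * measure ?\<sigma> UNIV" by simp
    finally have 1: "\<bar>(\<integral>\<theta>. G (p \<bullet> \<theta>) \<partial>?\<sigma>) - (\<integral>\<theta>. Q (p \<bullet> \<theta>) \<partial>?\<sigma>)\<bar> \<le> e * measure ?\<sigma> UNIV" .
    have "\<bar>integral {-1..1} (\<lambda>s. G s * (1 - s\<^sup>2) ^ k) - integral {-1..1} (\<lambda>s. Q s * (1 - s\<^sup>2) ^ k)\<bar> =
       norm (integral {-1..1} (\<lambda>s. G s * (1 - s\<^sup>2) ^ k - Q s * (1 - s\<^sup>2) ^ k))"
      using int[OF G] int[OF Qc] by (simp add: integral_diff)
    also have "\<dots> \<le> e * (1 - (-1))"
    proof (rule integral_bound)
      fix s :: real assume s: "s \<in> {-1..1}"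
      have "s\<^sup>2 \<le> 1" using s by (simp add: abs_square_le_1 abs_le_iff)
      then have "\<bar>(1 - s\<^sup>2) ^ k\<bar> \<le> 1" by (simp add: power_abs power_le_one)
      then have "\<bar>G s - Q s\<bar> * \<bar>(1 - s\<^sup>2) ^ k\<bar> \<le> e * 1"
        using Q(2)[OF s] e by (intro mult_mono) auto
      then show "norm (G s * (1 - s\<^sup>2) ^ k - Q s * (1 - s\<^sup>2) ^ k) \<le> e"
        by (simp add: abs_mult[symmetric] left_diff_distrib)
    qed (auto intro!: continuous_intros continuous_on_subset[OF G] continuous_on_subset[OF Qc])
    finally have 2: "\<bar>integral {-1..1} (\<lambda>s. G s * (1 - s\<^sup>2) ^ k) - integral {-1..1} (\<lambda>s. Q s * (1 - s\<^sup>2) ^ k)\<bar> \<le> e * 2"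
      by simp
    define a where "a = (\<integral>\<theta>. G (p \<bullet> \<theta>) \<partial>?\<sigma>) - (\<integral>\<theta>. Q (p \<bullet> \<theta>) \<partial>?\<sigma>)"
    define b where "b = integral {-1..1} (\<lambda>s. G s * (1 - s\<^sup>2) ^ k) - integral {-1..1} (\<lambda>s. Q s * (1 - s\<^sup>2) ^ k)"
    have "L G = L G - L Q" using L_poly QN by simp
    also have "\<dots> = a - ?w * b"
      unfolding L_def a_def b_def by (simp add: algebra_simps)
    finally have "\<bar>L G\<bar> = \<bar>a - ?w * b\<bar>" by simp
    also have "\<dots> \<le> \<bar>a\<bar> + ?w * \<bar>b\<bar>"
      using abs_triangle_ineq4[of a "?w * b"] w by (simp add: abs_mult)
    also have "\<dots> \<le> e * measure ?\<sigma> UNIV + ?w * (e * 2)"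
      using 1 2 w unfolding a_def b_def by (intro add_mono mult_left_mono) auto
    finally show ?thesis unfolding C_def by (simp add: algebra_simps)
  qed
  have "C > 0" unfolding C_def using w by (simp add: add_nonneg_pos)
  then have "\<bar>L G\<bar> \<le> 0 + d" if "d > 0" for d
  proof -
    have "\<bar>L G\<bar> \<le> d / C * C" using that bound[of "d / C"] \<open>C > 0\<close> by simp
    then show ?thesis using \<open>C > 0\<close> by simp
  qed
  then have "\<bar>L G\<bar> \<le> 0" by (rule field_le_epsilon)
  then show ?thesis unfolding L_def by simp
qed

section \<open>Iterates of the operator D\<close>

text \<open>Carrying all successive derivatives as explicit data makes products and reflections
  explicit formulas as well, free of \<open>deriv\<close>; \<open>S\<close> restricts them to where
  the functions are smooth.\<close>

definition derivative_chain :: "real set \<Rightarrow> (nat \<Rightarrow> real \<Rightarrow> real) \<Rightarrow> bool" where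
  "derivative_chain S F \<longleftrightarrow> (\<forall>m. \<forall>x\<in>S. (F m has_real_derivative F (Suc m) x) (at x))"

lemma derivative_chainD:
  "derivative_chain S F \<Longrightarrow> x \<in> S \<Longrightarrow> (F m has_real_derivative F (Suc m) x) (at x)"
  by (simp add: derivative_chain_def)

text \<open>Leibniz's rule. Passing from m to \<open>Suc m\<close> is Pascal's rule, once the terms
  in which B was differentiated are shifted by one index.\<close>

lemma derivative_chain_mult:
  assumes A: "derivative_chain S A" and B: "derivative_chain S B"
  shows "derivative_chain S (\<lambda>m x. \<Sum>j\<le>m. real (m choose j) * (A (m - j) x * B j x))"
  unfolding derivative_chain_def
proof (intro allI ballI)
  fix m x assume x: "x \<in> S"
  define T where "T j = A (Suc m - j) x * B j x" for j
  have "((\<lambda>x. \<Sum>j\<le>m. real (m choose j) * (A (m - j) x * B j x)) has_real_derivative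
      (\<Sum>j\<le>m. real (m choose j) * (A (Suc (m - j)) x * B j x + B (Suc j) x * A (m - j) x))) (at x)"
    by (intro DERIV_sum DERIV_cmult DERIV_mult derivative_chainD[OF A x] derivative_chainD[OF B x])
  moreover have "(\<Sum>j\<le>m. real (m choose j) * (A (Suc (m - j)) x * B j x + B (Suc j) x * A (m - j) x)) =
      (\<Sum>j\<le>Suc m. real (Suc m choose j) * (A (Suc m - j) x * B j x))"
  proof -
    have "(\<Sum>j\<le>m. real (m choose j) * (A (Suc (m - j)) x * B j x + B (Suc j) x * A (m - j) x)) =
        (\<Sum>j\<le>m. real (m choose j) * T j) + (\<Sum>j\<le>m. real (m choose j) * T (Suc j))"
      unfolding sum.distrib[symmetric] T_def by (intro sum.cong) (auto simp: Suc_diff_le algebra_simps)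
    also have "(\<Sum>j\<le>m. real (m choose j) * T j) = (\<Sum>j\<le>Suc m. real (m choose j) * T j)"
      by (simp add: binomial_eq_0)
    also have "\<dots> = T 0 + (\<Sum>j\<le>m. real (m choose Suc j) * T (Suc j))"
      by (subst sum.atMost_Suc_shift) simp
    finally show ?thesis
      by (subst sum.atMost_Suc_shift) (simp add: T_def sum.distrib[symmetric] algebra_simps)
  qed
  ultimately show "((\<lambda>x. \<Sum>j\<le>m. real (m choose j) * (A (m - j) x * B j x)) has_real_derivative
      (\<Sum>j\<le>Suc m. real (Suc m choose j) * (A (Suc m - j) x * B j x))) (at x)"
    by simp
qed

lemma derivative_chain_power:
  "derivative_chain S (\<lambda>m x. if m \<le> N then fact N / fact (N - m) * x ^ (N - m) else 0)"
  unfolding derivative_chain_def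
proof (intro allI ballI)
  fix m and x :: real
  show "((\<lambda>x. if m \<le> N then fact N / fact (N - m) * x ^ (N - m) else 0) has_real_derivative
      (if Suc m \<le> N then fact N / fact (N - Suc m) * x ^ (N - Suc m) else 0)) (at x)"
  proof (cases "Suc m \<le> N")
    case True
    then obtain d where N: "N = Suc m + d" using le_Suc_ex by blast
    have "((\<lambda>x. fact N / fact (Suc d) * x ^ Suc d) has_real_derivative
        fact N / fact (Suc d) * (real (Suc d) * x ^ (Suc d - Suc 0))) (at x)"
      by (intro DERIV_cmult DERIV_pow)
    moreover have "fact N / fact (Suc d) * (real (Suc d) * x ^ (Suc d - Suc 0)) = fact N / fact d * x ^ d"
      by (simp add: divide_simps del: of_nat_Suc)
    ultimately show ?thesis using N by (simp add: Suc_diff_le del: power_Suc fact_Suc)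
  next
    case False
    then show ?thesis by (cases "m \<le> N") (auto simp: not_less_eq_eq)
  qed
qed

lemma derivative_chain_cmult:
  "derivative_chain S F \<Longrightarrow> derivative_chain S (\<lambda>m x. c * F m x)"
  unfolding derivative_chain_def by (auto intro!: DERIV_cmult)

lemma derivative_chain_reflect:
  assumes "derivative_chain S F" "\<And>t. t \<in> T \<Longrightarrow> 1 - t \<in> S"
  shows "derivative_chain T (\<lambda>m t. (-1) ^ m * F m (1 - t))"
  unfolding derivative_chain_def
proof (intro allI ballI)
  fix m t assume "t \<in> T"
  then have "(F m has_real_derivative F (Suc m) (1 - t)) (at (1 - t))"
    using assms by (auto intro: derivative_chainD)
  then have "((\<lambda>t. F m (1 - t)) has_real_derivative F (Suc m) (1 - t) * (-1)) (at t)"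
    by (rule DERIV_chain2) (auto intro!: derivative_eq_intros)
  from DERIV_cmult[OF this, of "(-1) ^ m"]
  show "((\<lambda>t. (-1) ^ m * F m (1 - t)) has_real_derivative (-1) ^ Suc m * F (Suc m) (1 - t)) (at t)"
    by simp
qed

text \<open>
  The coefficients of the Bessel polynomials: $t D^i(\<phi>/t)$ is the sum of
  $(-1)^j (i+j)!/(j!\,(i-j)!\,2^j)\, t^{-i-j} \<phi>^{(i-j)}$ over $j \<le> i$.
\<close>

definition bessel_coeff :: "nat \<Rightarrow> nat \<Rightarrow> real" where
  "bessel_coeff i j = (if j \<le> i then (-1) ^ j * fact (i + j) / (fact j * fact (i - j) * 2 ^ j) else 0)"

lemma bessel_coeff_0 [simp]: "bessel_coeff i 0 = 1"
  by (simp add: bessel_coeff_def)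

text \<open>The recurrence that D imposes: differentiating 1/t^(i+j+1) contributes the factor
  -(i+j+1), while differentiating the chain keeps the coefficient. On the diagonal j = i the default
  value 0 enters.\<close>

lemma bessel_coeff_Suc_Suc:
  "bessel_coeff (Suc i) (Suc j) = bessel_coeff i (Suc j) - real (i + j + 1) * bessel_coeff i j"
proof -
  consider "j < i" | "j = i" | "j > i" by linarith
  then show ?thesis
  proof cases
    case 1
    then obtain d where i: "i = Suc j + d" by (metis Suc_leI le_Suc_ex)
    have f: "fact (Suc i + Suc j) = (real (i + j) + 2) * ((real (i + j) + 1) * fact (i + j))"
       "fact (i + Suc j) = (real (i + j) + 1) * (fact (i + j) :: real)"
       "fact (Suc j) = (real j + 1) * (fact j :: real)" by (simp_all add: algebra_simps)
    have s: "Suc i - Suc j = Suc d" "i - j = Suc d" "i - Suc j = d" using i by auto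
    have g: "fact (Suc d) = (real d + 1) * (fact d :: real)" by simp
    have pos: "real j + 1 > 0" "real d + 1 > 0" by auto
    have r: "real i = real j + 1 + real d" using i by simp
    have "(real (i + j) + 2) = 2 * (real j + 1) + (real d + 1)" using r by simp
    then show ?thesis using 1 pos
      unfolding bessel_coeff_def f s g power_Suc
      by (simp add: divide_simps) (simp add: algebra_simps)
  next
    case 2
    have f: "fact (Suc i + Suc i) = (2 * real i + 2) * ((2 * real i + 1) * fact (i + i))"
       "fact (Suc i) = (real i + 1) * (fact i :: real)" by (simp_all add: algebra_simps)
    have pos: "real i + 1 > 0" by auto
    show ?thesis using pos unfolding bessel_coeff_def 2 f power_Suc
      by (simp add: divide_simps) (simp add: algebra_simps)
  qed (simp add: bessel_coeff_def)
qed

text \<open>This is D^i(\<phi>/t), with the derivatives of \<phi> read off the chain.\<close>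

definition dop_chain :: "(nat \<Rightarrow> real \<Rightarrow> real) \<Rightarrow> nat \<Rightarrow> real \<Rightarrow> real" where
  "dop_chain \<phi> i t = (\<Sum>j\<le>i. bessel_coeff i j / t ^ (i + j + 1) * \<phi> (i - j) t)"

lemma dop_chain_0 [simp]: "dop_chain \<phi> 0 t = \<phi> 0 t / t"
  by (simp add: dop_chain_def)

lemma has_real_derivative_dop_chain:
  assumes \<phi>: "derivative_chain S \<phi>" and t: "t \<in> S" "t \<noteq> 0"
  shows "(dop_chain \<phi> i has_real_derivative t * dop_chain \<phi> (Suc i) t) (at t)"
proof -
  define T where "T j = \<phi> (Suc i - j) t / t ^ (i + j + 1)" for j
  have pow: "((\<lambda>t. c / t ^ n) has_real_derivative - (real n * c / t ^ (n + 1))) (at t)" for c and n :: nat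
  proof (rule DERIV_cong[OF DERIV_divide[OF DERIV_const DERIV_pow]])
    show "(0 * t ^ n - c * (real n * t ^ (n - Suc 0))) / (t ^ n * t ^ n) = - (real n * c / t ^ (n + 1))"
      using t(2) by (cases n) (simp_all add: field_simps)
  qed (use t(2) in simp)
  have "((\<lambda>t. \<Sum>j\<le>i. bessel_coeff i j / t ^ (i + j + 1) * \<phi> (i - j) t) has_real_derivative
     (\<Sum>j\<le>i. - (real (i + j + 1) * bessel_coeff i j / t ^ (i + j + 1 + 1)) * \<phi> (i - j) t
         + \<phi> (Suc (i - j)) t * (bessel_coeff i j / t ^ (i + j + 1)))) (at t)"
    by (intro DERIV_sum DERIV_mult pow derivative_chainD[OF \<phi> t(1)])
  moreover have "(\<Sum>j\<le>i. - (real (i + j + 1) * bessel_coeff i j / t ^ (i + j + 1 + 1)) * \<phi> (i - j) t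
         + \<phi> (Suc (i - j)) t * (bessel_coeff i j / t ^ (i + j + 1))) = t * dop_chain \<phi> (Suc i) t"
  proof -
    have "(\<Sum>j\<le>i. - (real (i + j + 1) * bessel_coeff i j / t ^ (i + j + 1 + 1)) * \<phi> (i - j) t
         + \<phi> (Suc (i - j)) t * (bessel_coeff i j / t ^ (i + j + 1)))
       = (\<Sum>j\<le>i. bessel_coeff i j * T j) - (\<Sum>j\<le>i. real (i + j + 1) * bessel_coeff i j * T (Suc j))"
      unfolding sum_subtractf[symmetric] T_def by (intro sum.cong) (auto simp: Suc_diff_le)
    \<comment> \<open>The added term is 0 because \<open>bessel_coeff i (Suc i)\<close> is; after
      the shift both sums run over the same range.\<close>
    also have "(\<Sum>j\<le>i. bessel_coeff i j * T j) = (\<Sum>j\<le>Suc i. bessel_coeff i j * T j)"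
      by (simp add: bessel_coeff_def)
    also have "\<dots> = T 0 + (\<Sum>j\<le>i. bessel_coeff i (Suc j) * T (Suc j))"
      by (subst sum.atMost_Suc_shift) simp
    also have "\<dots> - (\<Sum>j\<le>i. real (i + j + 1) * bessel_coeff i j * T (Suc j)) =
        T 0 + (\<Sum>j\<le>i. bessel_coeff (Suc i) (Suc j) * T (Suc j))"
      by (simp add: bessel_coeff_Suc_Suc left_diff_distrib sum_subtractf)
    also have "\<dots> = (\<Sum>j\<le>Suc i. bessel_coeff (Suc i) j * T j)"
      by (subst sum.atMost_Suc_shift) simp
    also have "\<dots> = t * dop_chain \<phi> (Suc i) t"
      unfolding dop_chain_def T_def sum_distrib_left using t(2)
      by (intro sum.cong) auto
    finally show ?thesis .
  qed
  ultimately show ?thesis unfolding dop_chain_def[abs_def] by simp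
qed

text \<open>\<open>J j\<close> stands for D^j applied to the integrand alone, and
  \<open>\<Phi> j\<close> for the boundary term released when \<open>J j\<close> is differentiated.
  Once released, \<Phi>/t undergoes all remaining applications of D, whence the sum of
  \<open>dop_chain\<close> terms.\<close>

lemma has_real_derivative_Dop_iterate:
  assumes S: "open S" "0 \<notin> S"
    and h: "\<And>t. t \<in> S \<Longrightarrow> h t = J 0 t"
    and J: "\<And>j t. t \<in> S \<Longrightarrow> (J j has_real_derivative t * J (Suc j) t + \<Phi> j 0 t) (at t)"
    and \<Phi>: "\<And>j. derivative_chain S (\<Phi> j)"
    and t: "t \<in> S"
  shows "((Dop ^^ j) h has_real_derivative
     t * J (Suc j) t + t * (\<Sum>i\<le>j. dop_chain (\<Phi> i) (j - i) t)) (at t)"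
  using t
proof (induction j arbitrary: t rule: less_induct)
  case (less j)
  \<comment> \<open>The closed form of D^j h. Since \<open>Dop\<close> differentiates the iterate
    itself, equality is needed on the whole open set and not just at \<open>t\<close>.\<close>
  define R where "R t = J j t + (\<Sum>i<j. dop_chain (\<Phi> i) (j - Suc i) t)" for t
  have eq: "(Dop ^^ j) h s = R s" if s: "s \<in> S" for s
  proof (cases j)
    case 0
    then show ?thesis using h[OF s] by (simp add: R_def)
  next
    case (Suc l)
    have "s \<noteq> 0" using s S by auto
    have "deriv ((Dop ^^ l) h) s = s * J j s + s * (\<Sum>i\<le>l. dop_chain (\<Phi> i) (l - i) s)"
      using less.IH[of l s] s Suc by (auto intro: DERIV_imp_deriv)
    then show ?thesis using \<open>s \<noteq> 0\<close> Suc
      by (simp add: R_def Dop_def lessThan_Suc_atMost field_simps)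
  qed
  have tS: "t \<in> S" "t \<noteq> 0" using less.prems S by auto
  have "(R has_real_derivative (t * J (Suc j) t + \<Phi> j 0 t) +
      (\<Sum>i<j. t * dop_chain (\<Phi> i) (Suc (j - Suc i)) t)) (at t)"
    unfolding R_def using tS
    by (intro DERIV_add J DERIV_sum has_real_derivative_dop_chain[OF \<Phi>]) auto
  moreover have "(\<Sum>i<j. t * dop_chain (\<Phi> i) (Suc (j - Suc i)) t) = (\<Sum>i<j. t * dop_chain (\<Phi> i) (j - i) t)"
    by (intro sum.cong) (auto simp: Suc_diff_Suc)
  ultimately have "(R has_real_derivative t * J (Suc j) t + t * (\<Sum>i\<le>j. dop_chain (\<Phi> i) (j - i) t)) (at t)"
    using tS by (simp add: sum_distrib_left lessThan_Suc_atMost[symmetric] algebra_simps)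
  then show ?case
    by (rule has_field_derivative_transform_within_open[OF _ S(1) tS(1)]) (simp add: eq)
qed

section \<open>Boundary terms\<close>

text \<open>Evaluating polynomials at t^2 lets \<open>pderiv\<close> realise D on the integrand up
  to the factor 2.\<close>

definition tail_integral :: "(real \<Rightarrow> real) \<Rightarrow> (real \<Rightarrow> real poly) \<Rightarrow> real \<Rightarrow> real" where
  "tail_integral w q t = integral {1 - t..1} (\<lambda>r. w r * poly (q r) (t\<^sup>2))"

lemma has_real_derivative_integral_lower:
  fixes c :: "real \<Rightarrow> real"
  assumes c: "continuous_on {0..1} c" and t: "0 < t" "t < 1"
  shows "((\<lambda>t. integral {1 - t..1} c) has_real_derivative c (1 - t)) (at t)"
proof -
  have "((\<lambda>u. integral {0..u} c) has_real_derivative c (1 - t)) (at (1 - t) within {0..1})"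
    using t by (intro integral_has_real_derivative c) auto
  then have "((\<lambda>u. integral {0..u} c) has_real_derivative c (1 - t)) (at (1 - t))"
    using t by (simp add: at_within_interior[of _ "{0..1}"])
  then have "((\<lambda>t. integral {0..1 - t} c) has_real_derivative c (1 - t) * (-1)) (at t)"
    by (rule DERIV_chain2) (auto intro!: derivative_eq_intros)
  then have "((\<lambda>t. integral {0..1} c - integral {0..1 - t} c) has_real_derivative 0 - c (1 - t) * (-1)) (at t)"
    by (intro DERIV_diff DERIV_const)
  then have "((\<lambda>t. integral {0..1} c - integral {0..1 - t} c) has_real_derivative c (1 - t)) (at t)"
    by simp
  moreover have "integral {0..1} c - integral {0..1 - s} c = integral {1 - s..1} c" if "s \<in> {0<..<1}" for s
    using Henstock_Kurzweil_Integration.integral_combine[of 0 "1 - s" 1 c] that integrable_continuous_interval[OF c] by simp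
  ultimately show ?thesis
    using t by (auto intro: has_field_derivative_transform_within_open[of _ _ _ "{0<..<1}"])
qed

lemma poly_eq_sum_atMost:
  fixes p :: "real poly"
  assumes "degree p \<le> N"
  shows "poly p x = (\<Sum>i\<le>N. coeff p i * x ^ i)"
  unfolding poly_altdef using assms by (intro sum.mono_neutral_left) (auto simp: coeff_eq_0)

text \<open>Expanding the polynomial leaves coefficient integrals in which t occurs only as the
  lower limit, so the fundamental theorem and the product rule suffice. The degree bound
  \<open>N\<close> makes the expansion the same finite sum for every r.\<close>

lemma has_real_derivative_tail_integral:
  assumes w: "continuous_on {0..1} w"
    and q: "\<And>i. continuous_on {0..1} (\<lambda>r. coeff (q r) i)" "\<And>r. degree (q r) \<le> N"
    and t: "0 < t" "t < 1"
  shows "(tail_integral w q has_real_derivative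
    2 * t * tail_integral w (\<lambda>r. pderiv (q r)) t + w (1 - t) * poly (q (1 - t)) (t\<^sup>2)) (at t)"
proof -
  define C where "C i t = integral {1 - t..1} (\<lambda>r. w r * coeff (q r) i)" for i t
  have cont: "continuous_on {0..1} (\<lambda>r. w r * coeff (q r) i)" for i
    by (intro continuous_intros w q)
  have int: "(\<lambda>r. w r * coeff (q r) i) integrable_on {1 - s..1}" if "s \<in> {0<..<1}" for s i
    using that by (intro integrable_continuous_interval continuous_on_subset[OF cont]) auto
  have eq: "tail_integral w q s = (\<Sum>i\<le>N. C i s * s ^ (2 * i))" if s: "s \<in> {0<..<1}" for s
  proof -
    have "tail_integral w q s = integral {1 - s..1} (\<lambda>r. \<Sum>i\<le>N. (w r * coeff (q r) i) * s ^ (2 * i))"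
      unfolding tail_integral_def poly_eq_sum_atMost[OF q(2)]
      by (simp add: sum_distrib_left power_mult mult.assoc)
    also have "\<dots> = (\<Sum>i\<le>N. C i s * s ^ (2 * i))"
      unfolding C_def using int[OF s]
      by (subst Henstock_Kurzweil_Integration.integral_sum)
         (auto simp: integral_mult_left integrable_on_mult_left)
    finally show ?thesis .
  qed
  have eq': "2 * t * tail_integral w (\<lambda>r. pderiv (q r)) t = (\<Sum>i\<le>N. (real (2 * i) * t ^ (2 * i - Suc 0)) * C i t)"
  proof -
    \<comment> \<open>Two derivatives of \<open>poly p (t\<^sup>2)\<close> are compared, one by the
      chain rule and one term by term.\<close>
    have "2 * t * poly (pderiv p) (t\<^sup>2) = (\<Sum>i\<le>N. coeff p i * (real (2 * i) * t ^ (2 * i - Suc 0)))"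
      if "degree p \<le> N" for p :: "real poly"
    proof -
      have "((\<lambda>t. poly p (t\<^sup>2)) has_real_derivative poly (pderiv p) (t\<^sup>2) * (real 2 * t ^ (2 - Suc 0))) (at t)"
        by (rule DERIV_chain2[OF poly_DERIV DERIV_pow])
      moreover have "((\<lambda>t. \<Sum>i\<le>N. coeff p i * t ^ (2 * i)) has_real_derivative
          (\<Sum>i\<le>N. coeff p i * (real (2 * i) * t ^ (2 * i - Suc 0)))) (at t)"
        by (intro DERIV_sum DERIV_cmult DERIV_pow)
      moreover have "(\<lambda>t. poly p (t\<^sup>2)) = (\<lambda>t. \<Sum>i\<le>N. coeff p i * t ^ (2 * i))"
        by (simp add: fun_eq_iff poly_eq_sum_atMost[OF that] power_mult)
      ultimately have "poly (pderiv p) (t\<^sup>2) * (real 2 * t ^ (2 - Suc 0)) =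
          (\<Sum>i\<le>N. coeff p i * (real (2 * i) * t ^ (2 * i - Suc 0)))"
        by (simp only:) (rule DERIV_unique)
      moreover have "2 * t * poly (pderiv p) (t\<^sup>2) = poly (pderiv p) (t\<^sup>2) * (real 2 * t ^ (2 - Suc 0))"
        by simp
      ultimately show ?thesis by (simp only:)
    qed
    then have "2 * t * (w r * poly (pderiv (q r)) (t\<^sup>2)) =
        w r * (\<Sum>i\<le>N. coeff (q r) i * (real (2 * i) * t ^ (2 * i - Suc 0)))" for r
      using q(2)[of r] by (simp only: mult.left_commute[of "2 * t"])
    then have "2 * t * tail_integral w (\<lambda>r. pderiv (q r)) t =
        integral {1 - t..1} (\<lambda>r. w r * (\<Sum>i\<le>N. coeff (q r) i * (real (2 * i) * t ^ (2 * i - Suc 0))))"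
      unfolding tail_integral_def
      by (simp only: Henstock_Kurzweil_Integration.integral_mult_right[symmetric])
    also have "\<dots> = integral {1 - t..1} (\<lambda>r. \<Sum>i\<le>N. (w r * coeff (q r) i) * (real (2 * i) * t ^ (2 * i - Suc 0)))"
      by (simp add: sum_distrib_left mult.assoc)
    also have "\<dots> = (\<Sum>i\<le>N. C i t * (real (2 * i) * t ^ (2 * i - Suc 0)))"
      unfolding C_def using int[of t] t
      by (subst Henstock_Kurzweil_Integration.integral_sum)
         (auto simp: integral_mult_left integrable_on_mult_left)
    finally show ?thesis by (simp only: mult.commute[of "C _ t"])
  qed
  have "((\<lambda>t. \<Sum>i\<le>N. C i t * t ^ (2 * i)) has_real_derivative
     (\<Sum>i\<le>N. (w (1 - t) * coeff (q (1 - t)) i) * t ^ (2 * i) + (real (2 * i) * t ^ (2 * i - Suc 0)) * C i t)) (at t)"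
    unfolding C_def by (intro DERIV_sum DERIV_mult DERIV_pow has_real_derivative_integral_lower[OF cont t])
  moreover have "(\<Sum>i\<le>N. (w (1 - t) * coeff (q (1 - t)) i) * t ^ (2 * i) + (real (2 * i) * t ^ (2 * i - Suc 0)) * C i t) =
     2 * t * tail_integral w (\<lambda>r. pderiv (q r)) t + w (1 - t) * poly (q (1 - t)) (t\<^sup>2)"
    unfolding sum.distrib eq' poly_eq_sum_atMost[OF q(2)]
    by (simp add: sum_distrib_left power_mult mult.assoc)
  ultimately have "((\<lambda>t. \<Sum>i\<le>N. C i t * t ^ (2 * i)) has_real_derivative
     2 * t * tail_integral w (\<lambda>r. pderiv (q r)) t + w (1 - t) * poly (q (1 - t)) (t\<^sup>2)) (at t)"
    by simp
  then show ?thesis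
    by (rule has_field_derivative_transform_within_open[of _ _ _ "{0<..<1}"]) (use t in \<open>auto simp: eq\<close>)
qed

section \<open>Derivatives of the kernel at its root\<close>

lemma higher_pderiv_pcompose_linear:
  "(pderiv ^^ j) (pcompose p [:a, 1:]) = pcompose ((pderiv ^^ j) p) [:a, 1:]" for p :: "real poly"
  by (induction j) (simp_all add: pderiv_pcompose pderiv_pCons)

text \<open>Shifting X to X + a turns the polynomial into X^k (X + a - b)^k, and the derivative of
  order j at a is j! times the coefficient of X^j. The root has order k and the degree is 2k, which
  gives the two cut-offs.\<close>

lemma poly_higher_pderiv_double_root:
  fixes a b :: real
  shows "poly ((pderiv ^^ j) (([:-a, 1:] * [:-b, 1:]) ^ k)) a =
    (if k \<le> j \<and> j \<le> 2 * k then fact j * real (k choose (j - k)) * (a - b) ^ (2 * k - j) else 0)"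
proof -
  let ?p = "([:-a, 1:] * [:-b, 1:]) ^ k"
  have power: "pcompose (p ^ k) [:a, 1:] = pcompose p [:a, 1:] ^ k" for p :: "real poly"
    by (induction k) (simp_all add: pcompose_mult pcompose_1)
  have "pcompose ([:-a, 1:] * [:-b, 1:]) [:a, 1:] = [:0, 1:] * [:a - b, 1:]"
    by (simp add: pcompose_mult pcompose_pCons)
  then have pc: "pcompose ?p [:a, 1:] = monom 1 k * [:a - b, 1:] ^ k"
    unfolding power by (simp only: power_mult_distrib monom_altdef smult_1_left)
  have "poly ((pderiv ^^ j) ?p) a = coeff (pcompose ((pderiv ^^ j) ?p) [:a, 1:]) 0"
    by (simp add: poly_0_coeff_0[symmetric] poly_pcompose)
  also have "\<dots> = fact j * coeff (pcompose ?p [:a, 1:]) j"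
    unfolding higher_pderiv_pcompose_linear[symmetric] coeff_higher_pderiv
    by (simp add: pochhammer_fact)
  also have "coeff (pcompose ?p [:a, 1:]) j = (if k \<le> j then coeff ([:a - b, 1:] ^ k) (j - k) else 0)"
    unfolding pc by (simp add: coeff_monom_mult)
  also have "\<dots> = (if k \<le> j \<and> j \<le> 2 * k then real (k choose (j - k)) * (a - b) ^ (2 * k - j) else 0)"
  proof -
    have "degree ([:a - b, 1:] ^ k) \<le> k"
      by (metis degree_linear_power order_refl)
    then show ?thesis
      by (auto simp: coeff_linear_poly_power coeff_eq_0 mult_2)
  qed
  finally show ?thesis by simp
qed

lemma continuous_on_coeff_mult:
  fixes p q :: "real \<Rightarrow> real poly"
  assumes "\<And>i. continuous_on S (\<lambda>r. coeff (p r) i)" "\<And>i. continuous_on S (\<lambda>r. coeff (q r) i)"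
  shows "continuous_on S (\<lambda>r. coeff (p r * q r) i)"
  unfolding coeff_mult by (intro continuous_intros assms)

lemma continuous_on_coeff_power:
  fixes p :: "real \<Rightarrow> real poly"
  assumes "\<And>i. continuous_on S (\<lambda>r. coeff (p r) i)"
  shows "continuous_on S (\<lambda>r. coeff (p r ^ k) i)"
  by (induction k arbitrary: i) (auto intro: continuous_on_coeff_mult assms)

lemma continuous_on_coeff_higher_pderiv:
  fixes p :: "real \<Rightarrow> real poly"
  assumes "\<And>i. continuous_on S (\<lambda>r. coeff (p r) i)"
  shows "continuous_on S (\<lambda>r. coeff ((pderiv ^^ j) (p r)) i)"
  unfolding coeff_higher_pderiv by (intro continuous_intros assms)

text \<open>The polynomial $P(r,t)^k$ as a polynomial in $t^2$.\<close>

definition sphere_kernel :: "nat \<Rightarrow> real \<Rightarrow> real poly" where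
  "sphere_kernel k r = smult ((-1) ^ k) (([:- ((1 - r)\<^sup>2), 1:] * [:- ((1 + r)\<^sup>2), 1:]) ^ k)"

text \<open>For s = (r^2 - 1 - t^2)/(2t) and t nonzero the right-hand side is (4 t^2 (1 - s^2))^k,
  the form produced by the substitution; the factored definition exposes the root (1-r)^2.\<close>

lemma poly_sphere_kernel: "poly (sphere_kernel k r) (t\<^sup>2) = (4 * t\<^sup>2 - (r\<^sup>2 - 1 - t\<^sup>2)\<^sup>2) ^ k"
proof -
  have "4 * t\<^sup>2 - (r\<^sup>2 - 1 - t\<^sup>2)\<^sup>2 = (-1) * ((t\<^sup>2 - (1 - r)\<^sup>2) * (t\<^sup>2 - (1 + r)\<^sup>2))"
    by (simp add: power2_eq_square algebra_simps)
  then show ?thesis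
    unfolding sphere_kernel_def by (simp only: power_mult_distrib) (simp add: power_mult_distrib)
qed

lemma degree_sphere_kernel: "degree (sphere_kernel k r) \<le> 2 * k"
proof -
  have "degree ([:- ((1 - r)\<^sup>2), 1:] * [:- ((1 + r)\<^sup>2), 1:]) \<le> 2"
    by simp
  then show ?thesis
    unfolding sphere_kernel_def
    by (intro order.trans[OF degree_smult_le] order.trans[OF degree_power_le]) simp
qed

lemma continuous_on_coeff_sphere_kernel: "continuous_on S (\<lambda>r. coeff (sphere_kernel k r) i)"
proof -
  have lin: "continuous_on S (\<lambda>r. coeff [:a r, 1:] i)" if "continuous_on S a" for a :: "real \<Rightarrow> real" and i
    using that by (cases i) (auto simp: coeff_pCons split: nat.split)
  show ?thesis
    unfolding sphere_kernel_def coeff_smult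
    by (intro continuous_intros continuous_on_coeff_power continuous_on_coeff_mult lin)
qed

text \<open>The factor 2^j turns j derivatives in t^2 into D^j, and -4 comes from (1-r)^2 - (1+r)^2
  = -4r at r = 1-t.\<close>

definition boundary_coeff :: "nat \<Rightarrow> nat \<Rightarrow> real" where
  "boundary_coeff k j = (if k \<le> j \<and> j \<le> 2 * k
     then (-1) ^ k * 2 ^ j * fact j * real (k choose (j - k)) * (-4) ^ (2 * k - j) else 0)"

lemma higher_pderiv_smult: "(pderiv ^^ j) (smult c p) = smult c ((pderiv ^^ j) p)" for p :: "real poly"
  by (induction j) (simp_all add: pderiv_smult)

lemma poly_higher_pderiv_sphere_kernel:
  "2 ^ j * poly ((pderiv ^^ j) (sphere_kernel k (1 - t))) (t\<^sup>2) = boundary_coeff k j * (1 - t) ^ (2 * k - j)"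
proof -
  have a: "(1 - (1 - t))\<^sup>2 = t\<^sup>2" by simp
  have b: "t\<^sup>2 - (1 + (1 - t))\<^sup>2 = (-4) * (1 - t)"
    by (simp add: power2_eq_square algebra_simps)
  show ?thesis
    unfolding sphere_kernel_def higher_pderiv_smult poly_smult a
    unfolding poly_higher_pderiv_double_root
    unfolding b power_mult_distrib boundary_coeff_def by simp
qed

text \<open>Collects the constants of one term of the triple sum. The signs (-1)^j from the Bessel
  coefficient, (-4)^l from the kernel and (-1)^(l-j) from reflecting t to 1-t combine to 4^l, so
  that only (-1)^k survives. The quotient of factorials is left by differentiating the power of
  order l + 1 exactly l - j - m times.\<close>

lemma boundary_coeff_bessel_coeff:
  assumes "j + m \<le> l" "l \<le> k"
  shows "bessel_coeff l j * boundary_coeff k (2 * k - l) * (-1) ^ (l - j) *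
      real ((l - j) choose m) * (fact (l + 1) / fact (j + m + 1)) =
    (-1) ^ k * fact k * 4 ^ k * (2 ^ (l - j) * (fact (2 * k - l) / (fact (k - l) * fact m)) *
      real ((l + 1) choose (j + m + 1)) * real ((l + j) choose j))"
proof -
  obtain d where l: "l = j + m + d" using assms(1) le_Suc_ex by blast
  obtain e where k: "k = l + e" using assms(2) le_Suc_ex by blast
  have B: "boundary_coeff k (2 * k - l) =
      (-1) ^ k * 2 ^ (2 * k - l) * fact (2 * k - l) * (fact k / (fact e * fact l)) * (-4) ^ l"
  proof -
    have "2 * k - l - k = e" "2 * k - (2 * k - l) = l" "k - e = l" "e \<le> k" using k by auto
    then show ?thesis using k unfolding boundary_coeff_def by (simp add: binomial_fact)
  qed
  have sgn: "(-1) ^ j * (-4) ^ l * (-1) ^ (l - j) = (4::real) ^ l"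
  proof -
    have s1: "(-1) ^ j * (-1) ^ (l - j) = (-1 :: real) ^ l"
      by (simp only: power_add[symmetric] le_add_diff_inverse[OF add_leD1[OF assms(1)]])
    have s2: "(-4 :: real) ^ l = (-1) ^ l * 4 ^ l"
      by (simp flip: power_mult_distrib)
    have "(-1) ^ j * (-4) ^ l * (-1) ^ (l - j) = ((-1) ^ j * (-1) ^ (l - j)) * (-4 :: real) ^ l"
      by (simp only: mult_ac)
    also have "\<dots> = 4 ^ l"
      unfolding s1 s2 by (simp flip: mult.assoc power_mult_distrib)
    finally show ?thesis .
  qed
  have two: "2 ^ (2 * k - l) * (4::real) ^ l / 2 ^ j = 4 ^ k * 2 ^ (l - j)"
  proof -
    have "2 * k - l = l + 2 * e" "l - j = m + d" using k l by auto
    then have "2 ^ (2 * k - l) * (4::real) ^ l = 2 ^ (l + 2 * e) * (2 ^ 2) ^ l" by simp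
    also have "\<dots> = (2 ^ 2) ^ k * 2 ^ (l - j) * 2 ^ j"
      unfolding power_mult[symmetric] power_add[symmetric] using k l by (simp add: algebra_simps)
    finally show ?thesis by simp
  qed
  have bin: "real ((l - j) choose m) = fact (l - j) / (fact m * fact d)"
    "real ((l + 1) choose (j + m + 1)) = fact (l + 1) / (fact (j + m + 1) * fact d)"
    "real ((l + j) choose j) = fact (l + j) / (fact j * fact l)"
    using l binomial_fact[of "j + m + 1" "l + 1", where 'a = real] by (simp_all add: binomial_fact del: fact_Suc binomial_Suc_Suc)
  have kl: "k - l = e" using k by simp
  have "bessel_coeff l j * boundary_coeff k (2 * k - l) * (-1) ^ (l - j) *
      real ((l - j) choose m) * (fact (l + 1) / fact (j + m + 1)) =
     (-1) ^ k * fact k * (((-1) ^ j * (-4) ^ l * (-1) ^ (l - j)) * 2 ^ (2 * k - l) / 2 ^ j) *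
       ((fact (2 * k - l) / (fact e * fact m)) *
       (fact (l + 1) / (fact (j + m + 1) * fact d)) * (fact (l + j) / (fact j * fact l)))"
    unfolding B bin bessel_coeff_def using l by (simp del: fact_Suc add: field_simps)
  also have "((-1) ^ j * (-4) ^ l * (-1) ^ (l - j)) * 2 ^ (2 * k - l) / 2 ^ j = (4::real) ^ k * 2 ^ (l - j)"
    unfolding sgn two[symmetric] by simp
  finally show ?thesis unfolding bin kl by (simp only: mult_ac)
qed

text \<open>The chain of x^N times \<open>G 0\<close>; the conditional is the derivative of x^N of
  order m - j.\<close>

definition leibniz_chain :: "nat \<Rightarrow> (nat \<Rightarrow> real \<Rightarrow> real) \<Rightarrow> nat \<Rightarrow> real \<Rightarrow> real" where
  "leibniz_chain N G m x = (\<Sum>j\<le>m. real (m choose j) *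
     ((if m - j \<le> N then fact N / fact (N - (m - j)) * x ^ (N - (m - j)) else 0) * G j x))"

lemma derivative_chain_leibniz_chain:
  "derivative_chain S G \<Longrightarrow> derivative_chain S (leibniz_chain N G)"
  unfolding leibniz_chain_def[abs_def] by (rule derivative_chain_mult[OF derivative_chain_power])

text \<open>The chain of the boundary term of stage j, a multiple of (1-t)^(2k-j+1) f(1-t). The
  kernel supplies 2k - j powers, the weight r one more, and the reflection the sign (-1)^m.\<close>

definition boundary_chain :: "nat \<Rightarrow> (nat \<Rightarrow> real \<Rightarrow> real) \<Rightarrow> nat \<Rightarrow> nat \<Rightarrow> real \<Rightarrow> real" where
  "boundary_chain k G j m t = boundary_coeff k j * ((-1) ^ m * leibniz_chain (2 * k - j + 1) G m (1 - t))"

lemma derivative_chain_boundary_chain: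
  assumes "derivative_chain {0<..} G"
  shows "derivative_chain {0<..<1} (boundary_chain k G j)"
  unfolding boundary_chain_def[abs_def]
  by (intro derivative_chain_cmult derivative_chain_reflect[where S = "{0<..}"] derivative_chain_leibniz_chain assms) auto

lemma dop_chain_boundary_chain:
  assumes l: "l \<le> k" and t: "t \<noteq> 0"
  shows "t * dop_chain (boundary_chain k G (2 * k - l)) l t =
    (\<Sum>j\<le>l. \<Sum>m\<le>l - j. (-1) ^ k * fact k * 4 ^ k * (2 ^ (l - j) * (fact (2 * k - l) / (fact (k - l) * fact m)) *
      real ((l + 1) choose (j + m + 1)) * real ((l + j) choose j)) *
      (1 / t ^ l * ((1 - t) ^ (j + m + 1) / t ^ j) * G m (1 - t)))"
  unfolding dop_chain_def boundary_chain_def leibniz_chain_def sum_distrib_left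
proof (intro sum.cong refl)
  fix j m assume jm: "j \<in> {..l}" "m \<in> {..l - j}"
  \<comment> \<open>At stage 2k - l the power has exponent l + 1, and at most l derivatives fall on
    it, so the conditional in \<open>leibniz_chain\<close> always holds.\<close>
  have N: "2 * k - (2 * k - l) + 1 = l + 1" and A: "l - j - m \<le> l + 1" "l + 1 - (l - j - m) = j + m + 1"
    and jml: "j + m \<le> l"
    using l jm by auto
  have tt: "t * (1 / t ^ (l + j + 1)) = 1 / t ^ l * (1 / t ^ j)"
    using t by (simp add: power_add)
  have "t * (bessel_coeff l j / t ^ (l + j + 1) * (boundary_coeff k (2 * k - l) *
      ((-1) ^ (l - j) * (real ((l - j) choose m) *
       ((if l - j - m \<le> 2 * k - (2 * k - l) + 1 then
         fact (2 * k - (2 * k - l) + 1) / fact (2 * k - (2 * k - l) + 1 - (l - j - m)) *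
          (1 - t) ^ (2 * k - (2 * k - l) + 1 - (l - j - m)) else 0) * G m (1 - t))))))
    = (bessel_coeff l j * boundary_coeff k (2 * k - l) * (-1) ^ (l - j) *
      real ((l - j) choose m) * (fact (l + 1) / fact (j + m + 1))) *
      ((t * (1 / t ^ (l + j + 1))) * (1 - t) ^ (j + m + 1) * G m (1 - t))"
    unfolding N A(2) if_P[OF A(1)] by (simp only: divide_inverse mult_ac mult_1)
  then show "t * (bessel_coeff l j / t ^ (l + j + 1) * (boundary_coeff k (2 * k - l) *
      ((-1) ^ (l - j) * (real ((l - j) choose m) *
       ((if l - j - m \<le> 2 * k - (2 * k - l) + 1 then
         fact (2 * k - (2 * k - l) + 1) / fact (2 * k - (2 * k - l) + 1 - (l - j - m)) *
          (1 - t) ^ (2 * k - (2 * k - l) + 1 - (l - j - m)) else 0) * G m (1 - t)))))) =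
    (-1) ^ k * fact k * 4 ^ k * (2 ^ (l - j) * (fact (2 * k - l) / (fact (k - l) * fact m)) *
      real ((l + 1) choose (j + m + 1)) * real ((l + j) choose j)) *
      (1 / t ^ l * ((1 - t) ^ (j + m + 1) / t ^ j) * G m (1 - t))"
    unfolding boundary_coeff_bessel_coeff[OF jml l] tt by (simp only: divide_inverse mult_ac mult_1)
qed

lemma sm_sum_eq_dop_chain:
  assumes t: "t \<noteq> 0"
  shows "sm_sum k (\<lambda>m. G m (1 - t)) t = t * (\<Sum>l\<le>k. dop_chain (boundary_chain k G (2 * k - l)) l t)"
proof -
  define X where "X m \<nu> l = 2 ^ (l + m - \<nu>) * (fact (2*k - l) / (fact (k - l) * fact m))
        * real ((l + 1) choose (\<nu> + 1)) * real ((l + \<nu> - m) choose (\<nu> - m))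
        * (1 / t ^ l) * ((1 - t) ^ (\<nu> + 1) / t ^ (\<nu> - m)) * G m (1 - t)" for m \<nu> l
  have "(\<Sum>m=0..k. \<Sum>\<nu>=m..k. \<Sum>l=\<nu>..k. X m \<nu> l) =
      (\<Sum>(m, \<nu>, l)\<in>(SIGMA m:{0..k}. SIGMA \<nu>:{m..k}. {\<nu>..k}). X m \<nu> l)"
    by (simp add: sum.Sigma)
  also have "\<dots> = (\<Sum>(l, j, m)\<in>(SIGMA l:{..k}. SIGMA j:{..l}. {..l - j}). X m (j + m) l)"
    \<comment> \<open>With j = \<nu> - m, the range m <= \<nu> <= l <= k becomes j <= l and m <= l -
      j, and l can be summed outermost.\<close>
    by (rule sum.reindex_bij_witness[where i = "\<lambda>(l, j, m). (m, j + m, l)" and j = "\<lambda>(m, \<nu>, l). (l, \<nu> - m, m)"]) auto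
  also have "\<dots> = (\<Sum>l\<le>k. \<Sum>j\<le>l. \<Sum>m\<le>l - j. X m (j + m) l)"
    by (simp add: sum.Sigma)
  finally have eq: "sm_sum k (\<lambda>m. G m (1 - t)) t = (\<Sum>l\<le>k. (-1) ^ k * fact k * 4 ^ k * (\<Sum>j\<le>l. \<Sum>m\<le>l - j. X m (j + m) l))"
    unfolding sm_sum_def X_def by (simp only: sum_distrib_left)
  have "(-1) ^ k * fact k * 4 ^ k * (\<Sum>j\<le>l. \<Sum>m\<le>l - j. X m (j + m) l) =
      t * dop_chain (boundary_chain k G (2 * k - l)) l t" if l: "l \<le> k" for l
    unfolding dop_chain_boundary_chain[OF l t] sum_distrib_left
  proof (intro sum.cong refl)
    fix j m assume "j \<in> {..l}" "m \<in> {..l - j}"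
    have "l + m - (j + m) = l - j" "l + (j + m) - m = l + j" "j + m - m = j" by auto
    then show "(-1) ^ k * fact k * 4 ^ k * X m (j + m) l =
      (-1) ^ k * fact k * 4 ^ k * (2 ^ (l - j) * (fact (2 * k - l) / (fact (k - l) * fact m)) *
      real ((l + 1) choose (j + m + 1)) * real ((l + j) choose j)) *
      (1 / t ^ l * ((1 - t) ^ (j + m + 1) / t ^ j) * G m (1 - t))"
      unfolding X_def by (simp only: mult.assoc)
  qed
  then show ?thesis unfolding eq by (simp add: sum_distrib_left)
qed

lemma Dop_iterate_tail_integral:
  assumes g: "continuous_on {0..1} g" and G: "derivative_chain {0<..} G" "G 0 = g"
    and h: "\<And>t. 0 < t \<Longrightarrow> t < 1 \<Longrightarrow> h t = tail_integral (\<lambda>r. r * g r) (sphere_kernel k) t"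
    and t: "0 < t" "t < 1"
  shows "((Dop ^^ (2 * k)) h has_real_derivative sm_sum k (\<lambda>m. G m (1 - t)) t) (at t)"
proof -
  let ?w = "\<lambda>r. r * g r"
  define J where "J j t = 2 ^ j * tail_integral ?w (\<lambda>r. (pderiv ^^ j) (sphere_kernel k r)) t" for j t
  have deg: "degree ((pderiv ^^ j) (sphere_kernel k r)) \<le> 2 * k" for j r
    using degree_sphere_kernel[of k r] by (simp add: degree_higher_pderiv)
  have J: "(J j has_real_derivative s * J (Suc j) s + boundary_chain k G j 0 s) (at s)" if s: "s \<in> {0<..<1}" for j s
  proof -
    have "(J j has_real_derivative 2 ^ j * (2 * s * tail_integral ?w (\<lambda>r. pderiv ((pderiv ^^ j) (sphere_kernel k r))) s
        + ?w (1 - s) * poly ((pderiv ^^ j) (sphere_kernel k (1 - s))) (s\<^sup>2))) (at s)"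
      unfolding J_def[abs_def] using s
      by (intro DERIV_cmult has_real_derivative_tail_integral[where N = "2 * k"] deg
          continuous_on_coeff_higher_pderiv continuous_on_coeff_sphere_kernel continuous_intros g) auto
    moreover have "2 ^ j * (2 * s * tail_integral ?w (\<lambda>r. pderiv ((pderiv ^^ j) (sphere_kernel k r))) s
        + ?w (1 - s) * poly ((pderiv ^^ j) (sphere_kernel k (1 - s))) (s\<^sup>2)) =
      s * J (Suc j) s + ?w (1 - s) * (2 ^ j * poly ((pderiv ^^ j) (sphere_kernel k (1 - s))) (s\<^sup>2))"
      unfolding J_def by (simp add: algebra_simps)
    moreover have "?w (1 - s) * (2 ^ j * poly ((pderiv ^^ j) (sphere_kernel k (1 - s))) (s\<^sup>2)) = boundary_chain k G j 0 s"
      unfolding poly_higher_pderiv_sphere_kernel boundary_chain_def leibniz_chain_def using G(2) by simp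
    ultimately show ?thesis by simp
  qed
  have "((Dop ^^ (2 * k)) h has_real_derivative
     t * J (Suc (2 * k)) t + t * (\<Sum>i\<le>2 * k. dop_chain (boundary_chain k G i) (2 * k - i) t)) (at t)"
  proof (rule has_real_derivative_Dop_iterate[where S = "{0<..<1}"])
    show "h s = J 0 s" if "s \<in> {0<..<1}" for s
      using that h by (simp add: J_def)
  qed (use t J derivative_chain_boundary_chain[OF G(1)] in auto)
  moreover have "J (Suc (2 * k)) t = 0"
  proof -
    have "(pderiv ^^ (Suc (2 * k))) (sphere_kernel k r) = 0" for r
      by (rule poly_eqI) (simp only: coeff_higher_pderiv, use degree_sphere_kernel[of k r] in \<open>simp add: coeff_eq_0\<close>)
    then show ?thesis unfolding J_def tail_integral_def by simp
  qed
  moreover have "(\<Sum>i\<le>2 * k. dop_chain (boundary_chain k G i) (2 * k - i) t) =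
      (\<Sum>l\<le>k. dop_chain (boundary_chain k G (2 * k - l)) l t)"
  proof -
    have "(\<Sum>i\<le>2 * k. dop_chain (boundary_chain k G i) (2 * k - i) t) =
        (\<Sum>l\<le>2 * k. dop_chain (boundary_chain k G (2 * k - l)) l t)"
      by (rule sum.reindex_bij_witness[where i = "\<lambda>l. 2 * k - l" and j = "\<lambda>i. 2 * k - i"]) auto
    also have "\<dots> = (\<Sum>l\<le>k. dop_chain (boundary_chain k G (2 * k - l)) l t)"
      \<comment> \<open>For l > k the stage 2k - l lies below k, where \<open>boundary_coeff\<close>
        is 0.\<close>
      by (rule sum.mono_neutral_right) (auto simp: dop_chain_def boundary_chain_def boundary_coeff_def)
    finally show ?thesis .
  qed
  ultimately show ?thesis
    using sm_sum_eq_dop_chain[of t k G] t by simp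
qed

section \<open>Uniqueness for the differential equation\<close>

text \<open>The squared length E of the vector of \<open>y 0\<close> up to order k - 1 satisfies
  |E'| <= C E, so a zero of E spreads in both directions.\<close>

lemma linear_ode_zero:
  fixes y :: "nat \<Rightarrow> real \<Rightarrow> real"
  assumes y: "\<And>i x. i < k \<Longrightarrow> x \<in> {a<..<b} \<Longrightarrow> (y i has_real_derivative y (Suc i) x) (at x)"
    and top: "\<And>x. x \<in> {a<..<b} \<Longrightarrow> y k x = (\<Sum>m<k. A m x * y m x)"
    and A: "\<And>m. m < k \<Longrightarrow> continuous_on {a<..<b} (A m)"
    and start: "start \<in> {a<..<b}" "\<And>i. i < k \<Longrightarrow> y i start = 0"
    and s: "s \<in> {a<..<b}" and i: "i < k"
  shows "y i s = 0"
proof -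
  \<comment> \<open>The coefficients may be unbounded near the ends of the open interval, so they
    are bounded on the compact segment between \<open>start\<close> and \<open>s\<close>.\<close>
  define c where "c = min s start"
  define d where "d = max s start"
  have sub: "{c..d} \<subseteq> {a<..<b}" using s start by (auto simp: c_def d_def)
  have "\<exists>B\<ge>0. \<forall>m<k. \<forall>x\<in>{c..d}. \<bar>A m x\<bar> \<le> B"
  proof -
    have "\<exists>B. \<forall>x\<in>{c..d}. \<bar>A m x\<bar> \<le> B" if "m < k" for m
    proof -
      have "bounded (A m ` {c..d})"
        using that sub by (intro compact_imp_bounded compact_continuous_image continuous_on_subset[OF A]) auto
      then show ?thesis by (auto simp: bounded_iff)
    qed
    then obtain B where B: "\<And>m x. m < k \<Longrightarrow> x \<in> {c..d} \<Longrightarrow> \<bar>A m x\<bar> \<le> B m" by metis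
    have "\<bar>A m x\<bar> \<le> (\<Sum>m<k. \<bar>B m\<bar>)" if "m < k" "x \<in> {c..d}" for m x
    proof -
      have "\<bar>A m x\<bar> \<le> \<bar>B m\<bar>" using B[OF that] by simp
      also have "\<dots> \<le> (\<Sum>m<k. \<bar>B m\<bar>)" using that by (intro member_le_sum) auto
      finally show ?thesis .
    qed
    then show ?thesis by (intro exI[of _ "\<Sum>m<k. \<bar>B m\<bar>"]) (auto intro: sum_nonneg)
  qed
  then obtain B where B: "B \<ge> 0" "\<And>m x. m < k \<Longrightarrow> x \<in> {c..d} \<Longrightarrow> \<bar>A m x\<bar> \<le> B" by blast
  define E where "E x = (\<Sum>i<k. (y i x)\<^sup>2)" for x
  define E' where "E' x = (\<Sum>i<k. 2 * y i x * y (Suc i) x)" for x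
  \<comment> \<open>Every \<open>y (Suc i)\<close> is at most (1 + k B) sqrt E: the 1 covers the
    shift to the next component, k B the top one, given by the equation. E' has k such products,
    each with factor 2.\<close>
  define C where "C = 2 * real k * (1 + real k * B)"
  have E0: "E x \<ge> 0" for x unfolding E_def by (intro sum_nonneg) auto
  have E_deriv: "(E has_real_derivative E' x) (at x)" if "x \<in> {c..d}" for x
    unfolding E_def E'_def using that sub
    by (auto intro!: derivative_eq_intros y sum.cong)
  have y_le: "\<bar>y i x\<bar> \<le> sqrt (E x)" if "i < k" for i x
    unfolding E_def using that by (intro real_le_rsqrt) (auto intro!: member_le_sum)
  have y_Suc_le: "\<bar>y (Suc i) x\<bar> \<le> (1 + real k * B) * sqrt (E x)" if "i < k" "x \<in> {c..d}" for i x
  proof (cases "Suc i < k")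
    case True
    have "\<bar>y (Suc i) x\<bar> \<le> 1 * sqrt (E x)" using y_le[OF True] by simp
    also have "\<dots> \<le> (1 + real k * B) * sqrt (E x)"
      using B(1) E0[of x] by (intro mult_right_mono) auto
    finally show ?thesis .
  next
    case False
    then have "Suc i = k" using that by simp
    then have "\<bar>y (Suc i) x\<bar> = \<bar>\<Sum>m<k. A m x * y m x\<bar>" using top that sub by auto
    also have "\<dots> \<le> (\<Sum>m<k. \<bar>A m x * y m x\<bar>)" by (rule sum_abs)
    also have "\<dots> \<le> (\<Sum>m<k. B * sqrt (E x))"
      using B that y_le by (intro sum_mono) (auto simp: abs_mult intro!: mult_mono)
    also have "\<dots> = real k * B * sqrt (E x)" by simp
    also have "\<dots> \<le> (1 + real k * B) * sqrt (E x)"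
      using E0[of x] by (intro mult_right_mono) auto
    finally show ?thesis .
  qed
  have E'_le: "\<bar>E' x\<bar> \<le> C * E x" if "x \<in> {c..d}" for x
  proof -
    have "\<bar>E' x\<bar> \<le> (\<Sum>i<k. \<bar>2 * y i x * y (Suc i) x\<bar>)" unfolding E'_def by (rule sum_abs)
    also have "\<dots> \<le> (\<Sum>i<k. 2 * (sqrt (E x) * ((1 + real k * B) * sqrt (E x))))"
    proof (rule sum_mono)
      fix i assume "i \<in> {..<k}"
      then have "\<bar>y i x\<bar> * \<bar>y (Suc i) x\<bar> \<le> sqrt (E x) * ((1 + real k * B) * sqrt (E x))"
        using y_le y_Suc_le that E0[of x] by (intro mult_mono) auto
      then show "\<bar>2 * y i x * y (Suc i) x\<bar> \<le> 2 * (sqrt (E x) * ((1 + real k * B) * sqrt (E x)))"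
        by (simp add: abs_mult)
    qed
    also have "\<dots> = C * (sqrt (E x) * sqrt (E x))" by (simp add: C_def)
    also have "\<dots> = C * E x" using E0[of x] by simp
    finally show ?thesis .
  qed
  have "E start = 0" unfolding E_def using start(2) by simp
  have "E s \<le> 0"
  \<comment> \<open>To the right of \<open>start\<close>, E times exp(-C x) is nonincreasing; to the
    left, E times exp(C x) is nondecreasing. Both compare E at \<open>s\<close> with its zero at
    \<open>start\<close>.\<close>
  proof (cases "start \<le> s")
    case True
    then have cd: "c = start" "d = s" by (auto simp: c_def d_def)
    have "E s * exp (- C * s) \<le> E start * exp (- C * start)"
    proof (rule DERIV_nonpos_imp_nonincreasing[OF True])
      fix x assume "start \<le> x" "x \<le> s"
      then have x: "x \<in> {c..d}" using cd by auto
      have "((\<lambda>x. E x * exp (- C * x)) has_real_derivative (E' x - C * E x) * exp (- C * x)) (at x)"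
        by (auto intro!: derivative_eq_intros E_deriv[OF x] simp: algebra_simps)
      moreover have "(E' x - C * E x) * exp (- C * x) \<le> 0"
        using E'_le[OF x] by (intro mult_nonpos_nonneg) auto
      ultimately show "\<exists>y. ((\<lambda>x. E x * exp (- C * x)) has_real_derivative y) (at x) \<and> y \<le> 0" by blast
    qed
    then show ?thesis using \<open>E start = 0\<close> by (simp add: mult_le_0_iff not_le)
  next
    case False
    then have cd: "c = s" "d = start" and le: "s \<le> start" by (auto simp: c_def d_def)
    have "E s * exp (C * s) \<le> E start * exp (C * start)"
    proof (rule DERIV_nonneg_imp_nondecreasing[OF le])
      fix x assume "s \<le> x" "x \<le> start"
      then have x: "x \<in> {c..d}" using cd by auto
      have "((\<lambda>x. E x * exp (C * x)) has_real_derivative (E' x + C * E x) * exp (C * x)) (at x)"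
        by (auto intro!: derivative_eq_intros E_deriv[OF x] simp: algebra_simps)
      moreover have "(E' x + C * E x) * exp (C * x) \<ge> 0"
        using E'_le[OF x] by (intro mult_nonneg_nonneg) auto
      ultimately show "\<exists>y. ((\<lambda>x. E x * exp (C * x)) has_real_derivative y) (at x) \<and> 0 \<le> y" by blast
    qed
    then show ?thesis using \<open>E start = 0\<close> by (simp add: mult_le_0_iff not_le)
  qed
  then have "sqrt (E s) \<le> 0" by simp
  then show ?thesis using y_le[OF i, of s] by linarith
qed

text \<open>Isolates the coefficient of \<open>F m\<close> in \<open>sm_sum\<close>, so that the
  identity can be read as a linear differential equation.\<close>

definition sm_weight :: "nat \<Rightarrow> nat \<Rightarrow> real \<Rightarrow> real" where
  "sm_weight k m t = (-1)^k * fact k * 4^k *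
     (\<Sum>\<nu>=m..k. \<Sum>l=\<nu>..k.
        2 ^ (l + m - \<nu>) * (fact (2*k - l) / (fact (k - l) * fact m))
        * real ((l + 1) choose (\<nu> + 1)) * real ((l + \<nu> - m) choose (\<nu> - m))
        * (1 / t ^ l) * ((1 - t) ^ (\<nu> + 1) / t ^ (\<nu> - m)))"

lemma sm_sum_eq_sum_weight: "sm_sum k F t = (\<Sum>m\<le>k. sm_weight k m t * F m)"
  unfolding sm_sum_def sm_weight_def atMost_atLeast0
  by (simp only: sum_distrib_left sum_distrib_right mult.assoc)

text \<open>For m = k only \<nu> = l = k remains, leaving a nonzero constant times
  (1-t)^(k+1)/t^k.\<close>

lemma sm_weight_top_nonzero: "0 < t \<Longrightarrow> t < 1 \<Longrightarrow> sm_weight k k t \<noteq> 0"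
  by (simp add: sm_weight_def)

lemma continuous_on_sm_weight: "continuous_on {0<..<1} (sm_weight k m)"
  unfolding sm_weight_def by (intro continuous_intros) auto

text \<open>The difference of two solutions satisfies the homogeneous equation; in the variable x =
  1 - t, division by the top weight brings it into the form of
  \<open>linear_ode_zero\<close>.\<close>

lemma sm_sum_ode_unique:
  assumes U: "\<And>i x. i < k \<Longrightarrow> x \<in> {\<epsilon><..<1} \<Longrightarrow> (U i has_real_derivative U (Suc i) x) (at x)"
    and V: "\<And>i x. i < k \<Longrightarrow> x \<in> {\<epsilon><..<1} \<Longrightarrow> (V i has_real_derivative V (Suc i) x) (at x)"
    and eq: "\<And>t. t \<in> {0<..<1 - \<epsilon>} \<Longrightarrow> sm_sum k (\<lambda>m. U m (1 - t)) t = sm_sum k (\<lambda>m. V m (1 - t)) t"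
    and start: "start \<in> {\<epsilon><..<1}" "\<And>i. i < k \<Longrightarrow> U i start = V i start"
    and \<epsilon>: "0 < \<epsilon>" and s: "s \<in> {\<epsilon><..<1}"
  shows "U 0 s = V 0 s"
proof -
  define y where "y i x = U i x - V i x" for i x
  define A where "A m x = - sm_weight k m (1 - x) / sm_weight k k (1 - x)" for m x
  have top: "y k x = (\<Sum>m<k. A m x * y m x)" if x: "x \<in> {\<epsilon><..<1}" for x
  proof -
    let ?K = "sm_weight k k (1 - x)"
    have "(\<Sum>m\<le>k. sm_weight k m (1 - x) * y m x) = 0"
      using eq[of "1 - x"] x unfolding sm_sum_eq_sum_weight y_def
      by (simp add: right_diff_distrib sum_subtractf)
    then have "?K * y k x = - (\<Sum>m<k. sm_weight k m (1 - x) * y m x)"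
      by (simp add: lessThan_Suc_atMost[symmetric])
    moreover have "?K \<noteq> 0" using x \<epsilon> by (intro sm_weight_top_nonzero) auto
    ultimately have "y k x = - (\<Sum>m<k. sm_weight k m (1 - x) * y m x) / ?K"
      by (simp add: field_simps)
    then show ?thesis by (simp add: A_def sum_divide_distrib sum_negf)
  qed
  show ?thesis
  proof (cases "k = 0")
    case True
    \<comment> \<open>For k = 0 the equation is algebraic: the empty sum already says that the
      difference vanishes.\<close>
    then show ?thesis using top[OF s] by (simp add: y_def)
  next
    case False
    have "y 0 s = 0"
    proof (rule linear_ode_zero[where k = k and a = \<epsilon> and b = 1 and A = A and y = y and start = start])
      show "(y i has_real_derivative y (Suc i) x) (at x)" if "i < k" "x \<in> {\<epsilon><..<1}" for i x
        unfolding y_def[abs_def] using that by (intro DERIV_diff U V)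
    next
      fix m assume "m < k"
      have "continuous_on {\<epsilon><..<1} (\<lambda>x. sm_weight k m (1 - x))" for m
        using \<epsilon> by (intro continuous_on_compose2[OF continuous_on_sm_weight] continuous_intros) auto
      moreover have "sm_weight k k (1 - x) \<noteq> 0" if "x \<in> {\<epsilon><..<1}" for x
        using that \<epsilon> by (intro sm_weight_top_nonzero) auto
      ultimately show "continuous_on {\<epsilon><..<1} (A m)"
        unfolding A_def by (intro continuous_intros) auto
    qed (use s start False top in \<open>auto simp: y_def\<close>)
    then show ?thesis by (simp add: y_def)
  qed
qed

section \<open>Radial functions\<close>

text \<open>Along a ray in direction \<open>e\<close> the profile is f itself, so its derivatives
  are iterated directional derivatives of f. This holds for r > 0 only: a two-sided derivative at 0
  would see negative arguments, on which f does not determine \<open>g\<close>.\<close>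

lemma C_infinity_profile_derivative_chain:
  fixes f :: "'a::euclidean_space \<Rightarrow> real" and g :: "real \<Rightarrow> real"
  assumes f: "C_infinity f" and g: "\<And>x. f x = g (norm x)"
  shows "derivative_chain {0<..} (\<lambda>m. (deriv ^^ m) g)"
proof -
  obtain e :: 'a where e: "norm e = 1" using vector_choose_size[of 1] by auto
  define F where "F m = foldr dir_deriv (replicate m e) f" for m
  have F: "((\<lambda>r. F m (r *\<^sub>R e)) has_real_derivative F (Suc m) (r *\<^sub>R e)) (at r)" for m r
  proof -
    have "F m differentiable at (r *\<^sub>R e)"
      using f unfolding C_infinity_def F_def by blast
    then have D: "(F m has_derivative frechet_derivative (F m) (at (r *\<^sub>R e))) (at (r *\<^sub>R e))"
      by (simp add: frechet_derivative_works)
    have "((\<lambda>r. F m (r *\<^sub>R e)) has_derivative (\<lambda>h. frechet_derivative (F m) (at (r *\<^sub>R e)) (h *\<^sub>R e))) (at r)"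
      by (rule has_derivative_compose[where f = "\<lambda>r. r *\<^sub>R e", OF _ D]) (auto intro!: derivative_eq_intros)
    moreover have "(\<lambda>h. frechet_derivative (F m) (at (r *\<^sub>R e)) (h *\<^sub>R e)) = (\<lambda>h. h * F (Suc m) (r *\<^sub>R e))"
      using has_derivative_bounded_linear[OF D]
      by (simp add: F_def dir_deriv_def fun_eq_iff linear_simps)
    ultimately show ?thesis
      by (simp add: has_field_derivative_def mult.commute[of _ "F (Suc m) (r *\<^sub>R e)"])
  qed
  have eq: "(deriv ^^ m) g r = F m (r *\<^sub>R e)" if "r > 0" for m r
    using that
  proof (induction m arbitrary: r)
    case 0
    then show ?case using g[of "r *\<^sub>R e"] e by (simp add: F_def)
  next
    case (Suc m)
    have "((deriv ^^ m) g has_real_derivative F (Suc m) (r *\<^sub>R e)) (at r)"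
      using F[of m r] by (rule has_field_derivative_transform_within_open[where S = "{0<..}"]) (use Suc in auto)
    then show ?case by (simp add: DERIV_imp_deriv)
  qed
  show ?thesis
    unfolding derivative_chain_def
  proof (intro allI ballI)
    fix m and r :: real assume r: "r \<in> {0<..}"
    show "((deriv ^^ m) g has_real_derivative (deriv ^^ Suc m) g r) (at r)"
      using F[of m r] unfolding eq[of r "Suc m", OF r[unfolded greaterThan_iff]]
      by (rule has_field_derivative_transform_within_open[where S = "{0<..}"]) (use eq r in auto)
  qed
qed

lemma higher_deriv_eq_0_on_open:
  fixes g :: "real \<Rightarrow> real"
  assumes "open S" "\<And>x. x \<in> S \<Longrightarrow> g x = 0" "x \<in> S"
  shows "(deriv ^^ m) g x = 0"
  using assms(3)
proof (induction m arbitrary: x)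
  case (Suc m)
  have "((deriv ^^ m) g has_real_derivative 0) (at x)"
    using DERIV_const[of 0 "at x"]
    by (rule has_field_derivative_transform_within_open[OF _ assms(1) Suc.prems]) (simp add: Suc.IH)
  then show ?case by (simp add: DERIV_imp_deriv)
qed (simp add: assms)

text \<open>The squared norm of p + t \<theta> is 1 + t^2 + 2t times
  \<open>p \<bullet> \<theta>\<close>, so the integrand depends on
  \<open>p \<bullet> \<theta>\<close> alone and \<open>Funk_Hecke\<close> applies.\<close>

lemma spherical_mean_radial:
  fixes f :: "'a::euclidean_space \<Rightarrow> real" and g :: "real \<Rightarrow> real"
  assumes n: "DIM('a) = 2 * k + 3" and f: "continuous_on UNIV f" and g: "\<And>x. f x = g (norm x)"
    and p: "norm p = 1"
  shows "spherical_mean f p t = sphere_area (2 * k + 1) / sphere_area (2 * k + 2) *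
    integral {-1..1} (\<lambda>s. g (\<bar>sqrt (1 + t\<^sup>2 + 2 * t * s)\<bar>) * (1 - s\<^sup>2) ^ k)"
proof -
  obtain e :: 'a where e: "norm e = 1" using vector_choose_size[of 1] by auto
  \<comment> \<open>\<open>sqrt\<close> is an odd function, so outside [-1, 1] the root can be
    negative. Going through f on a ray keeps \<open>G\<close> continuous on the whole line and
    produces the absolute value in the statement.\<close>
  define G where "G s = f (sqrt (1 + t\<^sup>2 + 2 * t * s) *\<^sub>R e)" for s
  have G: "continuous_on UNIV G"
    unfolding G_def by (intro continuous_on_compose2[OF f] continuous_intros) auto
  have Gg: "G s = g (\<bar>sqrt (1 + t\<^sup>2 + 2 * t * s)\<bar>)" for s
    unfolding G_def g using e by simp
  have [measurable]: "f \<in> borel_measurable borel" "G \<in> borel_measurable borel"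
    using f G by (auto intro: borel_measurable_continuous_onI)
  have "(\<integral>\<theta>. f (p + t *\<^sub>R \<theta>) \<partial>(sphere_surface_measure :: 'a measure)) = (\<integral>\<theta>. G (p \<bullet> \<theta>) \<partial>sphere_surface_measure)"
  proof (rule integral_cong_AE)
    show "AE \<theta> in (sphere_surface_measure :: 'a measure). f (p + t *\<^sub>R \<theta>) = G (p \<bullet> \<theta>)"
      using AE_sphere_surface_measure
    proof eventually_elim
      fix \<theta> :: 'a assume \<theta>: "norm \<theta> = 1"
      have "p \<bullet> p = 1" "\<theta> \<bullet> \<theta> = 1" using p \<theta> by (simp_all add: norm_eq_1)
      then have "(norm (p + t *\<^sub>R \<theta>))\<^sup>2 = 1 + t\<^sup>2 + 2 * t * (p \<bullet> \<theta>)"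
        unfolding power2_norm_eq_inner
        by (simp add: inner_add_left inner_add_right inner_commute power2_eq_square algebra_simps)
      then have "sqrt (1 + t\<^sup>2 + 2 * t * (p \<bullet> \<theta>)) = norm (p + t *\<^sub>R \<theta>)"
        by (metis norm_ge_zero real_sqrt_abs abs_of_nonneg)
      then show "f (p + t *\<^sub>R \<theta>) = G (p \<bullet> \<theta>)" unfolding Gg by (simp add: g)
    qed
  qed simp_all
  also have "\<dots> = sphere_area (2 * k + 1) * integral {-1..1} (\<lambda>s. G s * (1 - s\<^sup>2) ^ k)"
    by (rule Funk_Hecke[OF p n G])
  finally show ?thesis
    unfolding spherical_mean_def Gg n by simp
qed

text \<open>With s = (r^2 - 1 - t^2)/(2t) one has ds = (r/t) dr. The factor 4^k t^(2k) turns (1 -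
  s^2)^k into the kernel and the last t cancels 1/t, which accounts for the powers in the
  normalisation of h_k.\<close>

lemma integral_sphere_kernel_substitution:
  fixes g :: "real \<Rightarrow> real"
  assumes g: "continuous_on {0..} g" and supp: "\<And>r. r \<ge> 1 \<Longrightarrow> g r = 0" and t: "0 < t" "t < 1"
  shows "4 ^ k * t ^ (2 * k + 1) * integral {-1..1} (\<lambda>s. g (\<bar>sqrt (1 + t\<^sup>2 + 2 * t * s)\<bar>) * (1 - s\<^sup>2) ^ k) =
    tail_integral (\<lambda>r. r * g r) (sphere_kernel k) t"
proof -
  define \<phi> where "\<phi> r = (r\<^sup>2 - 1 - t\<^sup>2) / (2 * t)" for r
  define H where "H s = g (\<bar>sqrt (1 + t\<^sup>2 + 2 * t * s)\<bar>) * (1 - s\<^sup>2) ^ k" for s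
  define K where "K r = r * g r * poly (sphere_kernel k r) (t\<^sup>2)" for r
  have ends: "\<phi> (1 - t) = -1" "\<phi> (1 + t) = 1"
    using t by (auto simp: \<phi>_def power2_eq_square field_simps)
  have "\<phi> r \<in> {-1..1}" if r: "r \<in> {1 - t..1 + t}" for r
  proof -
    have "(1 - t)\<^sup>2 \<le> r\<^sup>2" "r\<^sup>2 \<le> (1 + t)\<^sup>2" using r t by (auto intro!: power_mono)
    then have "\<phi> (1 - t) \<le> \<phi> r" "\<phi> r \<le> \<phi> (1 + t)"
      unfolding \<phi>_def using t by (auto intro!: divide_right_mono)
    then show ?thesis using ends by simp
  qed
  then have "\<phi> ` {1 - t..1 + t} \<subseteq> {-1..1}" by blast
  moreover have "(\<phi> has_real_derivative r / t) (at r within {1 - t..1 + t})" for r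
    unfolding \<phi>_def using t by (auto intro!: derivative_eq_intros simp: field_simps)
  moreover have "continuous_on {-1..1} H"
    unfolding H_def by (intro continuous_intros continuous_on_compose2[OF g]) auto
  ultimately have "((\<lambda>r. (r / t) *\<^sub>R H (\<phi> r)) has_integral (integral {\<phi> (1 - t)..\<phi> (1 + t)} H)) {1 - t..1 + t}"
    using t ends by (intro has_integral_substitution[where c = "-1" and d = 1]) auto
  then have "((\<lambda>r. 4 ^ k * t ^ (2 * k + 1) * ((r / t) * H (\<phi> r))) has_integral
      4 ^ k * t ^ (2 * k + 1) * integral {-1..1} H) {1 - t..1 + t}"
    unfolding ends by (intro has_integral_mult_right) simp
  moreover have "4 ^ k * t ^ (2 * k + 1) * ((r / t) * H (\<phi> r)) = K r" if r: "r \<in> {1 - t..1 + t}" for r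
  proof -
    have "1 + t\<^sup>2 + 2 * t * \<phi> r = r\<^sup>2" using t by (simp add: \<phi>_def)
    then have gr: "g (\<bar>sqrt (1 + t\<^sup>2 + 2 * t * \<phi> r)\<bar>) = g r" using r t by simp
    have "4 * t\<^sup>2 * (1 - (\<phi> r)\<^sup>2) = 4 * t\<^sup>2 - (r\<^sup>2 - 1 - t\<^sup>2)\<^sup>2"
      using t by (simp add: \<phi>_def power_divide field_simps)
    then have "poly (sphere_kernel k r) (t\<^sup>2) = (4 * t\<^sup>2 * (1 - (\<phi> r)\<^sup>2)) ^ k"
      unfolding poly_sphere_kernel by simp
    also have "\<dots> = 4 ^ k * t ^ (2 * k) * (1 - (\<phi> r)\<^sup>2) ^ k"
      by (simp add: power_mult_distrib power_mult)
    finally show ?thesis unfolding K_def H_def gr using t by simp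
  qed
  ultimately have K: "(K has_integral 4 ^ k * t ^ (2 * k + 1) * integral {-1..1} H) {1 - t..1 + t}"
    by (rule has_integral_eq[rotated]) auto
  \<comment> \<open>The piece beyond r = 1 is split off because the profile vanishes there.\<close>
  have "integral {1 - t..1} K + integral {1..1 + t} K = integral {1 - t..1 + t} K"
    using K t by (intro Henstock_Kurzweil_Integration.integral_combine) (auto simp: has_integral_iff)
  moreover have "integral {1..1 + t} K = integral {1..1 + t} (\<lambda>_. 0)"
    by (rule integral_cong) (simp add: K_def supp)
  ultimately show ?thesis
    using K unfolding tail_integral_def K_def[symmetric] H_def[symmetric]
    by (simp add: has_integral_iff)
qed

section \<open>The identity for h_k and the recovery of the profile\<close>

lemma sphere_area_pos: "sphere_area m > 0"
  unfolding sphere_area_def by (simp add: Gamma_real_pos)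

text \<open>Recovery is expressed as uniqueness: \<open>s0\<close> is the point 1 - \<epsilon>', and
  t in (0, 1-\<epsilon>) corresponds to the radii 1 - t in (\<epsilon>, 1). That \<open>g\<close>
  itself solves the equation is the first conjunct.\<close>

theorem theorem2p1:
  fixes f :: "'a::euclidean_space \<Rightarrow> real" and g :: "real \<Rightarrow> real" and \<epsilon> :: real
  assumes "odd DIM('a)" and "DIM('a) \<ge> 3"
    and "0 < \<epsilon>" and "\<epsilon> < 1"
    and "C_infinity f"
    and "compact (closure {x. f x \<noteq> 0})" and "closure {x. f x \<noteq> 0} \<subseteq> ball 0 1"
    and "\<forall>x. f x = g (norm x)"
  shows "let k = (DIM('a) - 3) div 2 in
    \<forall>p. norm p = 1 \<longrightarrow>
      (let h = (\<lambda>s. 4 ^ k * sphere_area (2*k + 2) * s ^ (2*k + 1) / sphere_area (2*k + 1)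
                      * spherical_mean f p s)
       in (\<forall>t. 0 < t \<and> t < 1 \<longrightarrow>
             ((Dop ^^ (2*k)) h has_real_derivative
                sm_sum k (\<lambda>m. (deriv ^^ m) g (1 - t)) t) (at t))
        \<and> (\<forall>s0 u. \<epsilon> < s0 \<and> s0 < 1 \<and> s0 \<notin> closure {r. g r \<noteq> 0}
             \<and> (\<forall>i<k. \<forall>s\<in>{\<epsilon><..<1}. (deriv ^^ i) u differentiable (at s))
             \<and> (\<forall>i<k. (deriv ^^ i) u s0 = 0)
             \<and> (\<forall>t\<in>{0<..<1 - \<epsilon>}.
                   sm_sum k (\<lambda>m. (deriv ^^ m) u (1 - t)) t = deriv ((Dop ^^ (2*k)) h) t)
             \<longrightarrow> (\<forall>s\<in>{\<epsilon><..<1}. u s = g s)))"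
proof -
  define k where "k = (DIM('a) - 3) div 2"
  have n: "DIM('a) = 2 * k + 3"
    using assms(1,2) unfolding k_def by presburger
  have g: "f x = g (norm x)" for x using assms(8) by blast
  have chain: "derivative_chain {0<..} (\<lambda>m. (deriv ^^ m) g)"
    using C_infinity_profile_derivative_chain[OF assms(5)] g by blast
  have f_cont: "continuous_on UNIV f"
  proof -
    have "f differentiable at x" for x
      using assms(5) unfolding C_infinity_def by (metis foldr_Nil id_apply)
    then show ?thesis
      by (simp add: continuous_at_imp_continuous_on differentiable_imp_continuous_within)
  qed
  obtain e :: 'a where e: "norm e = 1" using vector_choose_size[of 1] by auto
  have g_eq: "g r = f (r *\<^sub>R e)" if "r \<ge> 0" for r
    using that e by (simp add: g)
  have g_cont: "continuous_on {0..} g"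
  proof -
    have "continuous_on {0..} (\<lambda>r. f (r *\<^sub>R e))"
      by (intro continuous_on_compose2[OF f_cont] continuous_intros) auto
    then show ?thesis by (rule continuous_on_eq) (simp add: g_eq)
  qed
  have supp: "g r = 0" if "r \<ge> 1" for r
  proof (rule ccontr)
    assume "g r \<noteq> 0"
    then have "r *\<^sub>R e \<in> closure {x. f x \<noteq> 0}"
      using that by (intro subsetD[OF closure_subset]) (simp add: g_eq)
    then have "r *\<^sub>R e \<in> ball 0 1" using assms(7) by blast
    then show False using that e by simp
  qed
  have main: "((Dop ^^ (2*k)) (\<lambda>s. 4 ^ k * sphere_area (2*k + 2) * s ^ (2*k + 1) / sphere_area (2*k + 1)
                      * spherical_mean f p s) has_real_derivative
                sm_sum k (\<lambda>m. (deriv ^^ m) g (1 - t)) t) (at t)"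
    if p: "norm p = 1" and t: "0 < t" "t < 1" for p t
  proof (rule Dop_iterate_tail_integral[where g = g])
    fix s :: real assume s: "0 < s" "s < 1"
    have T: "4 ^ k * s ^ (2 * k + 1) * integral {-1..1} (\<lambda>y. g \<bar>sqrt (1 + s\<^sup>2 + 2 * s * y)\<bar> * (1 - y\<^sup>2) ^ k) =
        tail_integral (\<lambda>r. r * g r) (sphere_kernel k) s"
      by (intro integral_sphere_kernel_substitution g_cont supp s)
    show "4 ^ k * sphere_area (2*k + 2) * s ^ (2*k + 1) / sphere_area (2*k + 1) * spherical_mean f p s =
       tail_integral (\<lambda>r. r * g r) (sphere_kernel k) s"
      \<comment> \<open>The sphere areas in \<open>h\<close> are the reciprocal of those in the
        radial formula for the mean.\<close>
      unfolding T[symmetric] spherical_mean_radial[OF n f_cont g p]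
      using sphere_area_pos[of "2 * k + 1"] sphere_area_pos[of "2 * k + 2"] by simp
  qed (use chain t in \<open>auto intro: continuous_on_subset[OF g_cont]\<close>)
  have unique: "u s = g s"
    if p: "norm p = 1" and s0: "\<epsilon> < s0" "s0 < 1" "s0 \<notin> closure {r. g r \<noteq> 0}"
      and diff: "\<forall>i<k. \<forall>s\<in>{\<epsilon><..<1}. (deriv ^^ i) u differentiable (at s)"
      and init: "\<forall>i<k. (deriv ^^ i) u s0 = 0"
      and ode: "\<forall>t\<in>{0<..<1 - \<epsilon>}. sm_sum k (\<lambda>m. (deriv ^^ m) u (1 - t)) t =
        deriv ((Dop ^^ (2*k)) (\<lambda>s. 4 ^ k * sphere_area (2*k + 2) * s ^ (2*k + 1) / sphere_area (2*k + 1)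
                      * spherical_mean f p s)) t"
      and s: "s \<in> {\<epsilon><..<1}" for p s0 u s
  proof -
    \<comment> \<open>The complement of the closed support is open, so \<open>g\<close> vanishes
      near \<open>s0\<close> and shares the initial values of \<open>u\<close>.\<close>
    have "(deriv ^^ i) g s0 = 0" for i
      using s0(3) closure_subset[of "{r. g r \<noteq> 0}"]
      by (intro higher_deriv_eq_0_on_open[where S = "- closure {r. g r \<noteq> 0}"]) auto
    moreover have "((deriv ^^ i) u has_real_derivative (deriv ^^ Suc i) u x) (at x)"
      if "i < k" "x \<in> {\<epsilon><..<1}" for i x
      using diff that by (simp add: DERIV_deriv_iff_real_differentiable)
    moreover have "((deriv ^^ i) g has_real_derivative (deriv ^^ Suc i) g x) (at x)"
      if "x \<in> {\<epsilon><..<1}" for i x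
      using derivative_chainD[OF chain, of x i] that assms(3) by simp
    moreover have "sm_sum k (\<lambda>m. (deriv ^^ m) u (1 - t)) t = sm_sum k (\<lambda>m. (deriv ^^ m) g (1 - t)) t"
      if "t \<in> {0<..<1 - \<epsilon>}" for t
      using ode that DERIV_imp_deriv[OF main[OF p, of t]] assms(3) by auto
    ultimately have "(deriv ^^ 0) u s = (deriv ^^ 0) g s"
      by (intro sm_sum_ode_unique[where k = k and \<epsilon> = \<epsilon> and U = "\<lambda>m. (deriv ^^ m) u"
            and V = "\<lambda>m. (deriv ^^ m) g" and start = s0])
         (use s s0 init assms(3) in auto)
    then show ?thesis by simp
  qed
  show ?thesis
    unfolding Let_def k_def[symmetric] using main unique by blast
qed

end
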